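(* Let $\alpha: G\curvearrowright X$ be a continuous action of a countably infinite discrete group $G$ on an infinite compact metrizable space $X$. Suppose in addition that $G$ is amenable or $\alpha$ is minimal. Then the following are equivalent. (i) Whenever $A,B$ are open sets in $X$ such that $\mu(B)>0$ for all $\mu\in M_G(X)$, if there is a positive integer $n$ such that $(n+1)A\prec nB$, then $A\prec B$. (ii) The action $\alpha: G\curvearrowright X$ has dynamical comparison, i.e., $V\prec O$ for all open sets $V,O\subset X$ with $O$ non-empty satisfying $\mu(V)<\mu(O)$ for every $\mu\in M_G(X)$.
   Context: $M_G(X)$ is the (possibly empty) convex set of $G$-invariant regular Borel probability measures on $X$. The action is minimal if every orbit is dense. Relation $\prec$: for finite sequences of open sets $O_1,\dots,O_n$ and $V_1,\dots,V_m$ in $X$, write $\bigsqcup_{i=1}^n O_i\times\{i\}\prec\bigsqcup_{l=1}^m V_l\times\{l\}$ if for every choice of closed sets $F_i\subset O_i$ ($i=1,\dots,n$) there are, for each $i$, a finite collection of open sets $U^{(i)}_1,\dots,U^{(i)}_{J_i}$ covering $F_i$, elements $s^{(i)}_1,\dots,s^{(i)}_{J_i}\in G$ and indices $k^{(i)}_1,\dots,k^{(i)}_{J_i}\in\{1,\dots,m\}$ such that the sets $s^{(i)}_jU^{(i)}_j\times\{k^{(i)}_j\}$ ($1\le i\le n$, $1\le j\le J_i$) are pairwise disjoint and all contained in $\bigsqcup_{l=1}^m V_l\times\{l\}$. For open sets $O,V$ and positive integers $n,m$, write $nO\prec mV$ if $\bigsqcup_{i=1}^n O\times\{i\}\prec\bigsqcup_{l=1}^m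 V\times\{l\}$, and write $O\prec V$ for the case $n=m=1$; thus $O\prec V$ means that for each closed $F\subset O$ there are finitely many open sets $U_1,\dots,U_J$ covering $F$ and $s_1,\dots,s_J\in G$ such that $s_1U_1,\dots,s_JU_J$ are pairwise disjoint subsets of $V$. *)

theory Defs
  imports "HOL-Probability.Probability_Measure" "HOL-Algebra.Group_Action"
begin

definition continuous_action ::
  "('g, 'b) monoid_scheme \<Rightarrow> ('g \<Rightarrow> 'x::topological_space \<Rightarrow> 'x) \<Rightarrow> bool"
where
  "continuous_action G \<alpha> \<longleftrightarrow>
     group_action G UNIV \<alpha> \<and>
     continuous_map (prod_topology (discrete_topology (carrier G)) euclidean) euclidean
       (\<lambda>(g, x). \<alpha> g x)"

definition minimal_action ::
  "('g, 'b) monoid_scheme \<Rightarrow> ('g \<Rightarrow> 'x::topological_space \<Rightarrow> 'x) \<Rightarrow> bool"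
where
  "minimal_action G \<alpha> \<longleftrightarrow> (\<forall>x. closure (orbit G \<alpha> x) = UNIV)"

text \<open>Amenability of a discrete group in the sense of von Neumann: there is a left-invariant
  finitely additive probability measure defined on all subsets.\<close>

definition amenable_group :: "('g, 'b) monoid_scheme \<Rightarrow> bool"
where
  "amenable_group G \<longleftrightarrow>
     (\<exists>m :: 'g set \<Rightarrow> real.
        (\<forall>A \<subseteq> carrier G. 0 \<le> m A) \<and>
        m (carrier G) = 1 \<and>
        (\<forall>A \<subseteq> carrier G. \<forall>B \<subseteq> carrier G. A \<inter> B = {} \<longrightarrow> m (A \<union> B) = m A + m B) \<and>
        (\<forall>g \<in> carrier G. \<forall>A \<subseteq> carrier G. m (g <#\<^bsub>G\<^esub> A) = m A))"

definition regular_measure :: "'x::topological_space measure \<Rightarrow> bool"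
where
  "regular_measure \<mu> \<longleftrightarrow>
     (\<forall>E \<in> sets borel.
        emeasure \<mu> E = (SUP K \<in> {K. compact K \<and> K \<subseteq> E}. emeasure \<mu> K) \<and>
        emeasure \<mu> E = (INF U \<in> {U. open U \<and> E \<subseteq> U}. emeasure \<mu> U))"

definition invariant_measures ::
  "('g, 'b) monoid_scheme \<Rightarrow> ('g \<Rightarrow> 'x::topological_space \<Rightarrow> 'x) \<Rightarrow> 'x measure set"
where
  "invariant_measures G \<alpha> =
     {\<mu>. prob_space \<mu> \<and> sets \<mu> = sets borel \<and> regular_measure \<mu> \<and>
         (\<forall>g \<in> carrier G. distr \<mu> borel (\<alpha> g) = \<mu>)}"

text \<open>The relation \<open>\<prec>\<close> between finite sequences of open sets, given as lists and indexed from 0;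
  \<open>nO \<prec> mV\<close> is the case of the lists \<open>replicate n O\<close> and \<open>replicate m V\<close>.  Disjointness is that of
  the family indexed by the pairs \<open>(i, j)\<close>, so two translates with different indices may coincide
  only if they are empty.\<close>

definition dyn_subequivalent ::
  "('g, 'b) monoid_scheme \<Rightarrow> ('g \<Rightarrow> 'x::topological_space \<Rightarrow> 'x) \<Rightarrow>
    'x set list \<Rightarrow> 'x set list \<Rightarrow> bool"
where
  "dyn_subequivalent G \<alpha> Os Vs \<longleftrightarrow>
     (\<forall>F :: nat \<Rightarrow> 'x set.
        (\<forall>i < length Os. closed (F i) \<and> F i \<subseteq> Os ! i) \<longrightarrow>
        (\<exists>(J :: nat \<Rightarrow> nat) (U :: nat \<Rightarrow> nat \<Rightarrow> 'x set) (s :: nat \<Rightarrow> nat \<Rightarrow> 'g) (k :: nat \<Rightarrow> nat \<Rightarrow> nat).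
           (\<forall>i < length Os.
              F i \<subseteq> (\<Union>j<J i. U i j) \<and>
              (\<forall>j < J i.
                 open (U i j) \<and> s i j \<in> carrier G \<and> k i j < length Vs \<and>
                 (\<alpha> (s i j) ` U i j) \<times> {k i j} \<subseteq> (\<Union>l<length Vs. (Vs ! l) \<times> {l}))) \<and>
           disjoint_family_on (\<lambda>(i, j). (\<alpha> (s i j) ` U i j) \<times> {k i j})
             (SIGMA i:{..<length Os}. {..<J i})))"

definition dynamical_comparison ::
  "('g, 'b) monoid_scheme \<Rightarrow> ('g \<Rightarrow> 'x::topological_space \<Rightarrow> 'x) \<Rightarrow> bool"
where
  "dynamical_comparison G \<alpha> \<longleftrightarrow>
     (\<forall>V W. open V \<longrightarrow> open W \<longrightarrow> W \<noteq> {} \<longrightarrow>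
        (\<forall>\<mu> \<in> invariant_measures G \<alpha>. measure \<mu> V < measure \<mu> W) \<longrightarrow>
        dyn_subequivalent G \<alpha> [V] [W])"

end

theory Submission
  imports Defs "HOL-Combinatorics.Permutations"
begin

text \<open>
  From comparison to cancellation the argument is a count: if \<open>(n+1)A \<prec> nB\<close>, the pieces covering
  \<open>n + 1\<close> copies of a closed \<open>F \<subseteq> A\<close> have disjoint translates in \<open>n\<close> copies of \<open>B\<close>, so
  \<open>(n+1) \<mu>(A) \<le> n \<mu>(B)\<close> for each invariant \<open>\<mu>\<close> by regularity
  (\<open>measure_le_if_dyn_subequivalent\<close>), whence \<open>\<mu>(A) < \<mu>(B)\<close> and comparison applies.

  For the converse, let \<open>\<mu>(V) < \<mu>(W)\<close> for every invariant \<open>\<mu>\<close>, let \<open>F \<subseteq> V\<close> be closed and let \<open>A\<close> be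
  open with \<open>F \<subseteq> A\<close> and \<open>closure A \<subseteq> V\<close>. By cancellation it suffices that \<open>(n+1)A \<prec> nW\<close> for some
  \<open>n > 0\<close> (\<open>multiple_below_if_measure_less\<close>). The relation \<open>\<prec>\<close> makes the finite multisets of open
  sets a preordered monoid, a generalized type semigroup. Every orbit meets \<open>W\<close>: in the minimal case by
  density, and in the amenable case because otherwise averaging along an orbit that avoids \<open>W\<close> gives
  an invariant measure vanishing on \<open>W\<close> (\<open>orbit_meets_if_amenable\<close>). By compactness \<open>W\<close> is then an
  order unit (\<open>order_unit\<close>). If no \<open>n\<close> worked, a Hahn-Banach argument on the monoid would give an
  additive monotone \<open>D\<close> with \<open>D(W) \<le> 1 \<le> D(A)\<close> (\<open>separating_state\<close>).

  On single open sets, \<open>D\<close> is monotone, subadditive, additive on disjoint sets and invariant. Its inner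
  regularization extends by Caratheodory's construction to a regular measure, invariant and, after
  scaling, of total mass one (\<open>invariant_measure_of_content\<close>). Regularization can only decrease the
  value of \<open>W\<close>, and it keeps that of \<open>V\<close> above the original value of \<open>A\<close> because
  \<open>closure A \<subseteq> V\<close>. Hence \<open>\<mu>(W) \<le> \<mu>(V)\<close>, a contradiction. If there is no invariant measure at all,
  the same argument applies: the hypothesis on \<open>\<mu>\<close> is then vacuous and the measure constructed from
  \<open>D\<close> is already the contradiction.
\<close>

section \<open>States on preordered multisets\<close>

text \<open>
  The functionals among which a state is sought, with additivity relaxed to subadditivity together
  with the superadditive half of homogeneity; subadditivity then gives the other half. The last two
  conditions are the normalization and the separation to be kept while the functional is made smaller.
\<close>

definition sub_state ::
  "('a multiset \<Rightarrow> 'a multiset \<Rightarrow> bool) \<Rightarrow> 'a multiset \<Rightarrow> 'a multiset \<Rightarrow> ('a multiset \<Rightarrow> real) \<Rightarrow> bool"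
where
  "sub_state prec_eq u a q \<longleftrightarrow>
     (\<forall>x. 0 \<le> q x) \<and> (\<forall>x y. prec_eq x y \<longrightarrow> q x \<le> q y) \<and> (\<forall>x y. q (x + y) \<le> q x + q y) \<and>
     (\<forall>n x. real n * q x \<le> q (repeat_mset n x)) \<and> q u \<le> 1 \<and> 1 \<le> q a"

text \<open>
  The price of \<open>x\<close> when it is bought together with many copies of \<open>b\<close>, for which the full price is
  refunded. It takes the place of the one-step extension in the Hahn-Banach theorem: a subadditive
  functional that equals its straightening along \<open>b\<close> is additive in the direction \<open>b\<close>.
\<close>

definition straighten :: "('a multiset \<Rightarrow> real) \<Rightarrow> 'a multiset \<Rightarrow> 'a multiset \<Rightarrow> real"
where
  "straighten q b x = (INF n. q (x + repeat_mset n b) - real n * q b)"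

locale preordered_multisets =
  fixes prec_eq :: "'a multiset \<Rightarrow> 'a multiset \<Rightarrow> bool" (infix "\<preceq>" 50)
  assumes le_refl: "x \<preceq> x"
    and le_trans [trans]: "x \<preceq> y \<Longrightarrow> y \<preceq> z \<Longrightarrow> x \<preceq> z"
    and le_add_right: "x \<preceq> y \<Longrightarrow> x + z \<preceq> y + z"
    and le_zero: "{#} \<preceq> x"
begin

lemma le_add: "x \<preceq> y \<Longrightarrow> x' \<preceq> y' \<Longrightarrow> x + x' \<preceq> y + y'"
  by (metis add.commute le_add_right le_trans)

lemma le_add_self: "x \<preceq> y + x"
  using le_add_right[OF le_zero, of x y] by simp

lemma le_repeat: "x \<preceq> y \<Longrightarrow> repeat_mset n x \<preceq> repeat_mset n y"
  by (induction n) (auto intro: le_refl le_add)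

lemma le_repeat_mono: "m \<le> n \<Longrightarrow> repeat_mset m x \<preceq> repeat_mset n x"
  by (metis le_add_diff_inverse2 le_add_self repeat_mset_distrib)

text \<open>
  By superhomogeneity, \<open>n\<close> copies of \<open>b\<close> already cost at least the refund, so the infimum defining
  \<open>straighten\<close> is over a set bounded below.
\<close>

lemma straighten_bdd:
  assumes "sub_state prec_eq u a q"
  shows "0 \<le> q (x + repeat_mset n b) - real n * q b"
proof -
  have "real n * q b \<le> q (repeat_mset n b)"
    using assms unfolding sub_state_def by blast
  also have "\<dots> \<le> q (x + repeat_mset n b)"
    using assms le_add_self unfolding sub_state_def by blast
  finally show ?thesis by simp
qed

lemma straighten_le:
  assumes "sub_state prec_eq u a q"
  shows "straighten q b x \<le> q (x + repeat_mset n b) - real n * q b"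
  unfolding straighten_def
  by (intro cINF_lower bdd_belowI2[where m=0] straighten_bdd[OF assms]) auto

lemma straighten_greatest:
  assumes "\<And>n. c \<le> q (x + repeat_mset n b) - real n * q b"
  shows "c \<le> straighten q b x"
  unfolding straighten_def using assms by (intro cINF_greatest) auto

text \<open>
  Straightening stays within the class of functionals considered, as long as the lower bound at \<open>a\<close>
  survives. Only homogeneity takes an argument: the bound for \<open>k\<close> copies of \<open>x\<close> is needed at every
  \<open>n\<close>, while the homogeneity of \<open>q\<close> speaks of multiples of \<open>k\<close>.
\<close>

lemma sub_state_straighten:
  assumes q: "sub_state prec_eq u a q" and a: "1 \<le> straighten q b a"
  shows "sub_state prec_eq u a (straighten q b)"
proof -
  have sub: "q (x + y) \<le> q x + q y" and mono: "x \<preceq> y \<Longrightarrow> q x \<le> q y"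
    and hom: "real n * q x \<le> q (repeat_mset n x)" and unit: "q u \<le> 1" and nonneg: "0 \<le> q x"
    for x y n using q unfolding sub_state_def by auto
  have hom': "q (repeat_mset n x) \<le> real n * q x" for n x
  proof (induction n)
    case 0
    have "2 * q {#} \<le> q {#}" using hom[of 2 "{#}"] by simp
    then show ?case by simp
  next
    case (Suc n)
    then show ?case using sub[of x "repeat_mset n x"] by (simp add: algebra_simps)
  qed
  show ?thesis
    unfolding sub_state_def
  proof (intro conjI allI impI)
    show "0 \<le> straighten q b x" for x
      using straighten_bdd[OF q] by (rule straighten_greatest)
    show "straighten q b x \<le> straighten q b y" if "x \<preceq> y" for x y
    proof (rule straighten_greatest)
      fix n
      have "q (x + repeat_mset n b) \<le> q (y + repeat_mset n b)"
        using that by (intro mono le_add_right)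
      then show "straighten q b x \<le> q (y + repeat_mset n b) - real n * q b"
        using straighten_le[OF q, of b x n] by linarith
    qed
    show "straighten q b (x + y) \<le> straighten q b x + straighten q b y" for x y
    proof -
      have "straighten q b (x + y) - (q (y + repeat_mset m b) - real m * q b) \<le> straighten q b x" for m
      proof (rule straighten_greatest)
        fix n
        have "q ((x + y) + repeat_mset (n + m) b) \<le> q (x + repeat_mset n b) + q (y + repeat_mset m b)"
          using sub[of "x + repeat_mset n b" "y + repeat_mset m b"]
          by (simp add: repeat_mset_distrib ac_simps)
        then show "straighten q b (x + y) - (q (y + repeat_mset m b) - real m * q b)
            \<le> q (x + repeat_mset n b) - real n * q b"
          using straighten_le[OF q, of b "x + y" "n + m"] by (simp add: algebra_simps)
      qed
      then have "straighten q b (x + y) - straighten q b x \<le> straighten q b y"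
        by (intro straighten_greatest) (simp add: algebra_simps)
      then show ?thesis by simp
    qed
    show "real k * straighten q b x \<le> straighten q b (repeat_mset k x)" for k x
    proof (cases "k = 0")
      case True
      then show ?thesis using straighten_bdd[OF q, of "{#}"] by (auto intro: straighten_greatest)
    next
      case False
      show ?thesis
      proof (rule straighten_greatest)
        fix n
        \<comment> \<open>Rounding \<open>n\<close> up to the multiple \<open>k * n\<close> of \<open>k\<close> costs at most \<open>r\<close> times \<open>q b\<close>.\<close>
        define r where "r = k * n - n"
        have n: "n + r = k * n" using False by (simp add: r_def)
        have "real k * q (x + repeat_mset n b) \<le> q (repeat_mset k x + repeat_mset (n + r) b)"
          using hom[of k "x + repeat_mset n b"] by (simp add: repeat_mset_distrib2 n)
        also have "\<dots> \<le> q (repeat_mset k x + repeat_mset n b) + q (repeat_mset r b)"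
          using sub[of "repeat_mset k x + repeat_mset n b" "repeat_mset r b"]
          by (simp add: repeat_mset_distrib add.assoc)
        also have "q (repeat_mset r b) \<le> real r * q b" by (rule hom')
        finally have 1: "real k * q (x + repeat_mset n b)
           \<le> q (repeat_mset k x + repeat_mset n b) + real r * q b" by simp
        have "real k * straighten q b x \<le> real k * (q (x + repeat_mset n b) - real n * q b)"
          by (intro mult_left_mono straighten_le[OF q]) auto
        moreover have "real (n + r) * q b = real (k * n) * q b" by (simp add: n)
        ultimately show "real k * straighten q b x
            \<le> q (repeat_mset k x + repeat_mset n b) - real n * q b"
          using 1 by (simp add: algebra_simps)
      qed
    qed
    show "straighten q b u \<le> 1" using straighten_le[OF q, of b u 0] unit by simp
    show "1 \<le> straighten q b a" by (rule a)
  qed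
qed

text \<open>
  The Minkowski gauge of the order unit: the smallest rational multiple of \<open>u\<close> that dominates \<open>x\<close> after
  clearing denominators.
\<close>

definition unit_rank :: "'a multiset \<Rightarrow> 'a multiset \<Rightarrow> real"
where
  "unit_rank u x = Inf {real m / real n | m n. n > 0 \<and> repeat_mset n x \<preceq> repeat_mset m u}"

lemma unit_rank_le:
  "n > 0 \<Longrightarrow> repeat_mset n x \<preceq> repeat_mset m u \<Longrightarrow> unit_rank u x \<le> real m / real n"
  unfolding unit_rank_def by (intro cInf_lower bdd_belowI[where m=0]) auto

lemma unit_rank_greatest:
  assumes "\<exists>n. x \<preceq> repeat_mset n u"
    and "\<And>m n. n > 0 \<Longrightarrow> repeat_mset n x \<preceq> repeat_mset m u \<Longrightarrow> c \<le> real m / real n"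
  shows "c \<le> unit_rank u x"
proof -
  obtain m where "x \<preceq> repeat_mset m u" using assms(1) by blast
  then have "repeat_mset 1 x \<preceq> repeat_mset m u" by simp
  then have "{real m / real n | m n. n > 0 \<and> repeat_mset n x \<preceq> repeat_mset m u} \<noteq> {}"
    by blast
  then show ?thesis unfolding unit_rank_def using assms(2) by (intro cInf_greatest) auto
qed

text \<open>
  The absence of strict domination \<open>(n+1) a \<preceq> n u\<close> is exactly the statement that the gauge of \<open>a\<close> is at
  least one.
\<close>

lemma sub_state_unit_rank:
  assumes unit: "\<And>x. \<exists>n. x \<preceq> repeat_mset n u"
    and not_le: "\<And>n. n > 0 \<Longrightarrow> \<not> repeat_mset (n + 1) a \<preceq> repeat_mset n u"
  shows "sub_state prec_eq u a (unit_rank u)"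
  unfolding sub_state_def
proof (intro conjI allI impI)
  show "0 \<le> unit_rank u x" for x by (intro unit_rank_greatest unit) simp
  show "unit_rank u x \<le> unit_rank u y" if "x \<preceq> y" for x y
    using that by (intro unit_rank_greatest unit unit_rank_le) (auto intro: le_trans le_repeat)
  show "unit_rank u (x + y) \<le> unit_rank u x + unit_rank u y" for x y
  proof -
    have *: "unit_rank u (x + y) \<le> real m / real n + real m' / real n'"
      if "n > 0" "n' > 0" "repeat_mset n x \<preceq> repeat_mset m u" "repeat_mset n' y \<preceq> repeat_mset m' u"
      for m n m' n'
    proof -
      have "repeat_mset (n * n') (x + y) = repeat_mset n' (repeat_mset n x) + repeat_mset n (repeat_mset n' y)"
        by (simp add: repeat_mset_distrib2 mult.commute)
      also have "\<dots> \<preceq> repeat_mset n' (repeat_mset m u) + repeat_mset n (repeat_mset m' u)"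
        using that by (intro le_add le_repeat)
      also have "\<dots> = repeat_mset (m * n' + m' * n) u"
        by (simp add: repeat_mset_distrib mult.commute)
      finally have "unit_rank u (x + y) \<le> real (m * n' + m' * n) / real (n * n')"
        using that by (intro unit_rank_le) auto
      also have "\<dots> = real m / real n + real m' / real n'" using that by (simp add: field_simps)
      finally show ?thesis .
    qed
    have "unit_rank u (x + y) - real m / real n \<le> unit_rank u y"
      if "n > 0" "repeat_mset n x \<preceq> repeat_mset m u" for m n
      using *[of n _ m] that by (intro unit_rank_greatest unit) (simp add: algebra_simps)
    then have "unit_rank u (x + y) - unit_rank u y \<le> unit_rank u x"
      by (intro unit_rank_greatest unit) (simp add: algebra_simps)
    then show ?thesis by simp
  qed
  show "real k * unit_rank u x \<le> unit_rank u (repeat_mset k x)" for k x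
  proof (cases "k = 0")
    case True
    then show ?thesis by (auto intro!: unit_rank_greatest unit)
  next
    case False
    show ?thesis
    proof (intro unit_rank_greatest unit)
      fix m n :: nat assume "n > 0" "repeat_mset n (repeat_mset k x) \<preceq> repeat_mset m u"
      then have "unit_rank u x \<le> real m / real (n * k)"
        using False by (intro unit_rank_le) auto
      then show "real k * unit_rank u x \<le> real m / real n"
        using False \<open>n > 0\<close> by (simp add: field_simps)
    qed
  qed
  show "unit_rank u u \<le> 1" using unit_rank_le[of 1 u 1 u] le_refl by simp
  show "1 \<le> unit_rank u a"
  proof (intro unit_rank_greatest unit)
    fix m n :: nat assume n: "n > 0" and dominated: "repeat_mset n a \<preceq> repeat_mset m u"
    have "m \<ge> n"
    proof (rule ccontr)
      assume "\<not> m \<ge> n"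
      then have m1: "repeat_mset (m + 1) a \<preceq> repeat_mset m u"
        using dominated by (intro le_trans[OF le_repeat_mono dominated]) auto
      show False
      \<comment> \<open>For \<open>m = 0\<close> the multiset \<open>a\<close> is null, and then already \<open>2 a \<preceq> u\<close>.\<close>
      proof (cases "m = 0")
        case False
        then show ?thesis using m1 not_le by auto
      next
        case True
        then have a0: "a \<preceq> {#}" using m1 by simp
        have "a + a \<preceq> {#} + {#}" using a0 by (intro le_add)
        also have "{#} + {#} \<preceq> u" using le_zero by simp
        finally show ?thesis using not_le[of 1] by simp
      qed
    qed
    then show "1 \<le> real m / real n" using n by simp
  qed
qed

text \<open>
  A Hahn-Banach theorem for preordered monoids. By Zorn's lemma there is a minimal functional \<open>q\<close> in the
  class above. Straightening \<open>q\<close> can only decrease it, so minimality makes \<open>q\<close> equal to each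
  straightening that stays in the class. Straightening along \<open>a\<close> does, as \<open>q\<close> keeps its value at \<open>a\<close>.
  Hence \<open>q\<close> is additive in the direction \<open>a\<close>, and this in turn shows that straightening along an
  arbitrary \<open>b\<close> keeps the lower bound at \<open>a\<close>.
\<close>

theorem separating_state:
  assumes unit: "\<And>x. \<exists>n. x \<preceq> repeat_mset n u"
    and not_le: "\<And>n. n > 0 \<Longrightarrow> \<not> repeat_mset (n + 1) a \<preceq> repeat_mset n u"
  obtains D :: "'a multiset \<Rightarrow> real"
  where "\<forall>x. 0 \<le> D x" "\<forall>x y. x \<preceq> y \<longrightarrow> D x \<le> D y" "\<forall>x y. D (x + y) = D x + D y"
    "D u \<le> 1" "1 \<le> D a"
proof -
  let ?S = "{q. sub_state prec_eq u a q}"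
  have "\<exists>q\<in>?S. \<forall>q'\<in>?S. q' \<le> q \<longrightarrow> q' = q"
  proof (rule predicate_Zorn[where P = "\<lambda>q q'. q' \<le> q"])
    show "partial_order_on ?S (relation_of (\<lambda>q q'. q' \<le> q) ?S)"
      by (rule partial_order_on_relation_ofI) auto
    fix C assume C: "C \<in> Chains (relation_of (\<lambda>q q'. q' \<le> q) ?S)"
    have S: "sub_state prec_eq u a c" if "c \<in> C" for c
      using C that unfolding Chains_def relation_of_def by blast
    have total: "c \<le> c' \<or> c' \<le> c" if "c \<in> C" "c' \<in> C" for c c'
      using C that unfolding Chains_def relation_of_def by blast
    show "\<exists>q\<in>?S. \<forall>c\<in>C. q \<le> c"
    proof (cases "C = {}")
      case True
      then show ?thesis using sub_state_unit_rank[OF assms] by auto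
    next
      case False
      define q where "q x = (INF c\<in>C. c x)" for x
      have low: "q x \<le> c x" if "c \<in> C" for c x
        unfolding q_def using that S
        by (intro cINF_lower bdd_belowI2[where m=0]) (auto simp: sub_state_def)
      have great: "r \<le> q x" if "\<And>c. c \<in> C \<Longrightarrow> r \<le> c x" for r x
        unfolding q_def using that False by (intro cINF_greatest) auto
      have "sub_state prec_eq u a q"
        unfolding sub_state_def
      proof (intro conjI allI impI)
        show "0 \<le> q x" for x using S by (intro great) (auto simp: sub_state_def)
        show "q x \<le> q y" if "x \<preceq> y" for x y
        proof (rule great)
          fix c assume "c \<in> C"
          then show "q x \<le> c y" using low[of c x] S[of c] that by (force simp: sub_state_def)
        qed
        show "q (x + y) \<le> q x + q y" for x y
        proof -
          \<comment> \<open>Two members of the chain may be replaced by the smaller of them.\<close>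
          have *: "q (x + y) \<le> c x + c' y" if cc: "c \<in> C" "c' \<in> C" for c c'
          proof -
            obtain d where d: "d \<in> C" "d \<le> c" "d \<le> c'" using total[OF cc] cc by auto
            have "q (x + y) \<le> d (x + y)" using d by (intro low)
            also have "\<dots> \<le> d x + d y" using S[OF d(1)] by (auto simp: sub_state_def)
            also have "\<dots> \<le> c x + c' y" using d by (auto simp: le_fun_def intro: add_mono)
            finally show ?thesis .
          qed
          have "q (x + y) - c' y \<le> q x" if "c' \<in> C" for c'
            using *[OF _ that] by (intro great) (simp add: algebra_simps)
          then have "q (x + y) - q x \<le> q y"
            by (intro great) (simp add: algebra_simps)
          then show ?thesis by simp
        qed
        show "real n * q x \<le> q (repeat_mset n x)" for n x
        proof (rule great)
          fix c assume "c \<in> C"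
          then have "real n * q x \<le> real n * c x" by (intro mult_left_mono low) auto
          also have "\<dots> \<le> c (repeat_mset n x)" using S[OF \<open>c \<in> C\<close>] by (auto simp: sub_state_def)
          finally show "real n * q x \<le> c (repeat_mset n x)" .
        qed
        obtain c where "c \<in> C" using False by blast
        then show "q u \<le> 1" using low[of c u] S[of c] by (auto simp: sub_state_def)
        show "1 \<le> q a" using S by (intro great) (auto simp: sub_state_def)
      qed
      then show ?thesis using low by (auto simp: le_fun_def)
    qed
  qed
  then obtain q where q: "sub_state prec_eq u a q"
    and min: "\<And>q'. sub_state prec_eq u a q' \<Longrightarrow> q' \<le> q \<Longrightarrow> q' = q" by blast
  have sub: "q (x + y) \<le> q x + q y" and mono: "x \<preceq> y \<Longrightarrow> q x \<le> q y"
    and hom: "real n * q x \<le> q (repeat_mset n x)" and nonneg: "0 \<le> q x"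
    and unit1: "q u \<le> 1" and a1: "1 \<le> q a"
    for x y n using q unfolding sub_state_def by auto
  have super: "q x + q b \<le> q (x + b)" if "1 \<le> straighten q b a" for x b
  proof -
    have "straighten q b \<le> q" using straighten_le[OF q, of b _ 0] by (auto simp: le_fun_def)
    then have "straighten q b = q" using sub_state_straighten[OF q that] by (rule min[rotated])
    then show ?thesis using straighten_le[OF q, of b x 1] by simp
  qed
  have super_a: "q x + q a \<le> q (x + a)" for x
  proof (rule super, rule straighten_greatest)
    fix n show "1 \<le> q (a + repeat_mset n a) - real n * q a"
      using hom[of "Suc n" a] a1 by (simp add: algebra_simps)
  qed
  have "q x + q b \<le> q (x + b)" for x b
  proof (rule super, rule straighten_greatest)
    fix n
    have "real n * q b + q a \<le> q (repeat_mset n b + a)"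
      using hom[of n b] super_a[of "repeat_mset n b"] by linarith
    then show "1 \<le> q (a + repeat_mset n b) - real n * q b"
      using a1 by (simp add: add.commute)
  qed
  then have "q (x + y) = q x + q y" for x y using sub[of x y] by (simp add: antisym)
  then show ?thesis by (intro that[of q]) (simp_all add: nonneg mono unit1 a1)
qed

end

section \<open>Shrinking open covers of compact sets\<close>

text \<open>
  The index set of the copies is discrete, and the product of the space with it is to be regular.
\<close>

instance nat :: t3_space
proof
  fix S :: "nat set" and y assume "y \<notin> S"
  then show "\<exists>U V. open U \<and> open V \<and> y \<in> U \<and> S \<subseteq> V \<and> U \<inter> V = {}"
    by - (rule exI[of _ "{y}"], rule exI[of _ S], auto simp: open_discrete)
qed

lemma t3_shrink:
  fixes x :: "'a::t3_space"
  assumes "open U" "x \<in> U"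
  obtains V where "open V" "x \<in> V" "closure V \<subseteq> U"
proof -
  obtain A where A: "closed A" "A \<subseteq> U" "eventually (\<lambda>y. y \<in> A) (nhds x)"
    using nhds_closed[OF assms(2,1)] by blast
  then obtain V where V: "open V" "x \<in> V" "\<forall>y\<in>V. y \<in> A"
    unfolding eventually_nhds by blast
  then have "closure V \<subseteq> A" using A(1) by (intro closure_minimal) auto
  with A(2) V(1,2) show ?thesis by (intro that) auto
qed

instance prod :: (t3_space, t3_space) t3_space
proof
  fix S :: "('a \<times> 'b) set" and y assume "closed S" "y \<notin> S"
  then have "open (- S)" "y \<in> - S" by auto
  then obtain A B where AB: "open A" "open B" "y \<in> A \<times> B" "A \<times> B \<subseteq> - S"
    by (rule open_prod_elim)
  then have y: "fst y \<in> A" "snd y \<in> B" by auto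
  obtain A' where A': "open A'" "fst y \<in> A'" "closure A' \<subseteq> A" by (rule t3_shrink[OF AB(1) y(1)])
  obtain B' where B': "open B'" "snd y \<in> B'" "closure B' \<subseteq> B" by (rule t3_shrink[OF AB(2) y(2)])
  show "\<exists>U V. open U \<and> open V \<and> y \<in> U \<and> S \<subseteq> V \<and> U \<inter> V = {}"
  proof (rule exI[of _ "A' \<times> B'"], rule exI[of _ "- (closure A' \<times> closure B')"], intro conjI)
    show "open (A' \<times> B')" using A' B' by (simp add: open_Times)
    show "open (- (closure A' \<times> closure B'))" by (intro open_Compl closed_Times closed_closure)
    show "y \<in> A' \<times> B'" using A' B' by (simp add: mem_Times_iff)
    show "S \<subseteq> - (closure A' \<times> closure B')" using AB(4) A'(3) B'(3) by blast
    show "A' \<times> B' \<inter> - (closure A' \<times> closure B') = {}"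
      using closure_subset[of A'] closure_subset[of B'] by blast
  qed
qed

text \<open>
  Each point of \<open>K\<close> has a neighbourhood whose closure lies in some \<open>U p\<close>; finitely many of them suffice,
  and \<open>W p\<close> collects those that were chosen for \<open>p\<close>.
\<close>

lemma compact_shrinking:
  fixes K :: "'a::t3_space set"
  assumes K: "compact K" and U: "\<And>p. p \<in> P \<Longrightarrow> open (U p)"
    and cover: "K \<subseteq> (\<Union>p\<in>P. U p)"
  obtains W where "\<forall>p. open (W p)" "\<forall>p\<in>P. closure (W p) \<subseteq> U p"
    "K \<subseteq> (\<Union>p\<in>P. W p)"
proof -
  have "\<forall>x\<in>K. \<exists>p N. p \<in> P \<and> open N \<and> x \<in> N \<and> closure N \<subseteq> U p"
  proof
    fix x assume "x \<in> K"
    then obtain p where p: "p \<in> P" "x \<in> U p" using cover by blast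
    obtain N where "open N" "x \<in> N" "closure N \<subseteq> U p"
      by (rule t3_shrink[OF U[OF p(1)] p(2)])
    with p show "\<exists>p N. p \<in> P \<and> open N \<and> x \<in> N \<and> closure N \<subseteq> U p" by blast
  qed
  then obtain p where "\<forall>x\<in>K. \<exists>N. p x \<in> P \<and> open N \<and> x \<in> N \<and> closure N \<subseteq> U (p x)"
    by (rule bchoice[THEN exE])
  then obtain N where pN: "\<forall>x\<in>K. p x \<in> P \<and> open (N x) \<and> x \<in> N x \<and> closure (N x) \<subseteq> U (p x)"
    by (rule bchoice[THEN exE])
  have op: "open (N x)" if "x \<in> K" for x using pN that by simp
  have "x \<in> N x" if "x \<in> K" for x using pN that by simp
  then have cov: "K \<subseteq> (\<Union>x\<in>K. N x)" by blast
  obtain T where T: "T \<subseteq> K" "finite T" "K \<subseteq> (\<Union>x\<in>T. N x)"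
    by (rule compactE_image[OF K op cov])
  define W where "W q = (\<Union>x\<in>{x\<in>T. p x = q}. N x)" for q
  have W_cl: "closure (W q) \<subseteq> U q" for q
  proof -
    have "closure (W q) \<subseteq> (\<Union>x\<in>{x\<in>T. p x = q}. closure (N x))"
      unfolding W_def using T(2)
      by (intro closure_minimal closed_UN UN_mono closure_subset ballI closed_closure) auto
    also have "\<dots> \<subseteq> U q"
    proof (rule UN_least)
      fix x assume "x \<in> {x\<in>T. p x = q}"
      then show "closure (N x) \<subseteq> U q" using pN T(1) by auto
    qed
    finally show ?thesis .
  qed
  have W_op: "open (W q)" for q unfolding W_def using T(1) by (intro open_UN ballI op) auto
  have "K \<subseteq> (\<Union>q\<in>P. W q)"
  proof
    fix y assume "y \<in> K"
    then obtain x where x: "x \<in> T" "y \<in> N x" using T(3) by blast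
    then have "y \<in> W (p x)" unfolding W_def by blast
    moreover have "p x \<in> P" using pN T(1) x(1) by auto
    ultimately show "y \<in> (\<Union>q\<in>P. W q)" by blast
  qed
  with W_cl W_op show ?thesis by (intro that[of W]) simp_all
qed

section \<open>Packing by partial homeomorphisms\<close>

text \<open>
  One instance of \<open>\<prec>\<close>: a set \<open>K\<close> is covered by finitely many open pieces, which maps from \<open>H\<close> carry to
  disjoint subsets of \<open>B\<close>. A map need only be injective on the piece that it moves, so that copies of a
  space can be rearranged by maps acting on the index alone, such as truncated shifts and constants.
\<close>

definition packs :: "('y::topological_space \<Rightarrow> 'y) set \<Rightarrow> 'y set \<Rightarrow> 'y set \<Rightarrow> bool"
where
  "packs H K B \<longleftrightarrow>
     (\<exists>P. finite P \<and>
        (\<forall>p\<in>P. open (fst p) \<and> snd p \<in> H \<and> inj_on (snd p) (fst p) \<and> snd p ` fst p \<subseteq> B) \<and>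
        K \<subseteq> (\<Union>p\<in>P. fst p) \<and>
        disjoint_family_on (\<lambda>p. snd p ` fst p) P)"

lemma packsE:
  assumes "packs H K B"
  obtains P where "finite P"
    "\<forall>p\<in>P. open (fst p)" "\<forall>p\<in>P. snd p \<in> H"
    "\<forall>p\<in>P. inj_on (snd p) (fst p)" "\<forall>p\<in>P. snd p ` fst p \<subseteq> B"
    "K \<subseteq> (\<Union>p\<in>P. fst p)"
    "\<forall>p\<in>P. \<forall>q\<in>P. p \<noteq> q \<longrightarrow> snd p ` fst p \<inter> snd q ` fst q = {}"
proof -
  from assms obtain P where P: "finite P"
    "\<forall>p\<in>P. open (fst p) \<and> snd p \<in> H \<and> inj_on (snd p) (fst p) \<and> snd p ` fst p \<subseteq> B"
    "K \<subseteq> (\<Union>p\<in>P. fst p)" "disjoint_family_on (\<lambda>p. snd p ` fst p) P"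
    unfolding packs_def by (elim exE conjE)
  show ?thesis
    by (rule that[of P]) (use P in \<open>simp_all add: disjoint_family_on_def\<close>)
qed

lemma packsI:
  assumes "finite P"
    "\<And>p. p \<in> P \<Longrightarrow> open (fst p)" "\<And>p. p \<in> P \<Longrightarrow> snd p \<in> H"
    "\<And>p. p \<in> P \<Longrightarrow> inj_on (snd p) (fst p)" "\<And>p. p \<in> P \<Longrightarrow> snd p ` fst p \<subseteq> B"
    "K \<subseteq> (\<Union>p\<in>P. fst p)"
    "\<And>p q. p \<in> P \<Longrightarrow> q \<in> P \<Longrightarrow> p \<noteq> q \<Longrightarrow> snd p ` fst p \<inter> snd q ` fst q = {}"
  shows "packs H K B"
  unfolding packs_def by (intro exI[of _ P]) (use assms in \<open>simp add: disjoint_family_on_def\<close>)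

definition below :: "('y::topological_space \<Rightarrow> 'y) set \<Rightarrow> 'y set \<Rightarrow> 'y set \<Rightarrow> bool"
where "below H A B \<longleftrightarrow> (\<forall>K. compact K \<longrightarrow> K \<subseteq> A \<longrightarrow> packs H K B)"

lemma belowI: "(\<And>K. compact K \<Longrightarrow> K \<subseteq> A \<Longrightarrow> packs H K B) \<Longrightarrow> below H A B"
  unfolding below_def by simp

lemma belowD: "below H A B \<Longrightarrow> compact K \<Longrightarrow> K \<subseteq> A \<Longrightarrow> packs H K B"
  unfolding below_def by simp

lemma below_empty: "below H {} B"
  by (rule belowI, rule packsI[of "{}"]) auto

lemma below_single:
  assumes "open A" "h \<in> H" "inj_on h A" "h ` A \<subseteq> B"
  shows "below H A B"
  by (rule belowI, rule packsI[of "{(A, h)}"]) (use assms in auto)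

text \<open>
  A compact subset of the union is split by shrinking into compact subsets of the two parts. The sources
  may overlap: only the targets have to be disjoint.
\<close>

lemma below_Un:
  fixes A1 :: "'y::t3_space set"
  assumes "open A1" "open A2" and b: "below H A1 B1" "below H A2 B2" and disj: "B1 \<inter> B2 = {}"
  shows "below H (A1 \<union> A2) (B1 \<union> B2)"
proof (rule belowI)
  fix K assume K: "compact K" "K \<subseteq> A1 \<union> A2"
  define A where "A i = (if i then A1 else A2)" for i
  obtain W where W0: "\<forall>i. open (W i)" "\<forall>i\<in>UNIV. closure (W i) \<subseteq> A i" "K \<subseteq> (\<Union>i. W i)"
  proof (rule compact_shrinking[OF K(1), of UNIV A])
    show "open (A i)" for i using assms(1,2) by (simp add: A_def)
    show "K \<subseteq> (\<Union>i. A i)" using K(2) by (simp only: UN_bool_eq) (simp add: A_def)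
  qed
  note W = W0[rule_format]
  have cl: "closure (W True) \<subseteq> A1" "closure (W False) \<subseteq> A2"
    using W(2)[OF UNIV_I, of True] W(2)[OF UNIV_I, of False] by (simp_all add: A_def)
  have KW: "K \<subseteq> W True \<union> W False" using W(3) by (simp only: UN_bool_eq)
  have p1: "packs H (K \<inter> closure (W True)) B1"
    using cl K(1) by (intro belowD[OF b(1)] compact_Int_closed) auto
  have p2: "packs H (K \<inter> closure (W False)) B2"
    using cl K(1) by (intro belowD[OF b(2)] compact_Int_closed) auto
  obtain P where P0: "finite P"
    "\<forall>p\<in>P. open (fst p)" "\<forall>p\<in>P. snd p \<in> H"
    "\<forall>p\<in>P. inj_on (snd p) (fst p)" "\<forall>p\<in>P. snd p ` fst p \<subseteq> B1"
    "K \<inter> closure (W True) \<subseteq> (\<Union>p\<in>P. fst p)"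
    "\<forall>p\<in>P. \<forall>q\<in>P. p \<noteq> q \<longrightarrow> snd p ` fst p \<inter> snd q ` fst q = {}"
    by (rule packsE[OF p1])
  note P = P0[rule_format]
  obtain Q where Q0: "finite Q"
    "\<forall>p\<in>Q. open (fst p)" "\<forall>p\<in>Q. snd p \<in> H"
    "\<forall>p\<in>Q. inj_on (snd p) (fst p)" "\<forall>p\<in>Q. snd p ` fst p \<subseteq> B2"
    "K \<inter> closure (W False) \<subseteq> (\<Union>p\<in>Q. fst p)"
    "\<forall>p\<in>Q. \<forall>q\<in>Q. p \<noteq> q \<longrightarrow> snd p ` fst p \<inter> snd q ` fst q = {}"
    by (rule packsE[OF p2])
  note Q = Q0[rule_format]
  show "packs H K (B1 \<union> B2)"
  proof (rule packsI[of "P \<union> Q"])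
    show "finite (P \<union> Q)" using P(1) Q(1) by simp
    fix p assume "p \<in> P \<union> Q"
    then show "open (fst p)" "snd p \<in> H" "inj_on (snd p) (fst p)" "snd p ` fst p \<subseteq> B1 \<union> B2"
      using P(2-5) Q(2-5) by blast+
    fix q assume "p \<in> P \<union> Q" "q \<in> P \<union> Q" "p \<noteq> q"
    then consider "p \<in> P" "q \<in> P" | "p \<in> Q" "q \<in> Q" | "p \<in> P" "q \<in> Q" | "p \<in> Q" "q \<in> P"
      by blast
    then show "snd p ` fst p \<inter> snd q ` fst q = {}"
    proof cases
      case 1 then show ?thesis using P(7) \<open>p \<noteq> q\<close> by blast
    next
      case 2 then show ?thesis using Q(7) \<open>p \<noteq> q\<close> by blast
    next
      case 3 then show ?thesis using P(5)[of p] Q(5)[of q] disj by blast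
    next
      case 4 then show ?thesis using P(5)[of q] Q(5)[of p] disj by blast
    qed
  next
    have "K \<subseteq> (K \<inter> closure (W True)) \<union> (K \<inter> closure (W False))"
      using KW closure_subset[of "W True"] closure_subset[of "W False"] by blast
    then show "K \<subseteq> (\<Union>p\<in>P \<union> Q. fst p)" using P(6) Q(6) by blast
  qed
qed

text \<open>
  The first packing is shrunk so that the translates of its pieces make up a compact subset of \<open>B\<close>, to
  which the second packing applies; the composite packing consists of the pieces of the first pulled
  apart along the second.
\<close>

lemma below_trans:
  fixes A :: "'y::t3_space set"
  assumes cont: "\<And>h. h \<in> H \<Longrightarrow> continuous_on UNIV h"
    and comp: "\<And>h h'. h \<in> H \<Longrightarrow> h' \<in> H \<Longrightarrow> h' \<circ> h \<in> H"
    and AB: "below H A B" and BC: "below H B C"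
  shows "below H A C"
proof (rule belowI)
  fix K assume K: "compact K" "K \<subseteq> A"
  obtain P where P0: "finite P"
    "\<forall>p\<in>P. open (fst p)" "\<forall>p\<in>P. snd p \<in> H"
    "\<forall>p\<in>P. inj_on (snd p) (fst p)" "\<forall>p\<in>P. snd p ` fst p \<subseteq> B"
    "K \<subseteq> (\<Union>p\<in>P. fst p)"
    "\<forall>p\<in>P. \<forall>q\<in>P. p \<noteq> q \<longrightarrow> snd p ` fst p \<inter> snd q ` fst q = {}"
    by (rule packsE[OF belowD[OF AB K]])
  note P = P0[rule_format]
  obtain W where W0: "\<forall>p. open (W p)" "\<forall>p\<in>P. closure (W p) \<subseteq> fst p" "K \<subseteq> (\<Union>p\<in>P. W p)"
    by (rule compact_shrinking[OF K(1) P(2,6)])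
  note W = W0[rule_format]
  define L where "L = (\<Union>p\<in>P. snd p ` (K \<inter> closure (W p)))"
  have "compact L"
    unfolding L_def
  proof (intro compact_UN P(1) compact_continuous_image)
    fix p assume "p \<in> P"
    then show "continuous_on (K \<inter> closure (W p)) (snd p)"
      using cont[OF P(3)] continuous_on_subset by blast
    show "compact (K \<inter> closure (W p))" using K(1) by (simp add: compact_Int_closed)
  qed
  moreover have "L \<subseteq> B" unfolding L_def using P(5) W(2) by blast
  ultimately have pL: "packs H L C" by (rule belowD[OF BC])
  obtain Q where Q0: "finite Q"
    "\<forall>p\<in>Q. open (fst p)" "\<forall>p\<in>Q. snd p \<in> H"
    "\<forall>p\<in>Q. inj_on (snd p) (fst p)" "\<forall>p\<in>Q. snd p ` fst p \<subseteq> C"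
    "L \<subseteq> (\<Union>p\<in>Q. fst p)"
    "\<forall>p\<in>Q. \<forall>q\<in>Q. p \<noteq> q \<longrightarrow> snd p ` fst p \<inter> snd q ` fst q = {}"
    by (rule packsE[OF pL])
  note Q = Q0[rule_format]
  define c :: "('y set \<times> ('y \<Rightarrow> 'y)) \<times> ('y set \<times> ('y \<Rightarrow> 'y)) \<Rightarrow> 'y set \<times> ('y \<Rightarrow> 'y)"
    where "c = (\<lambda>(p, q). (fst p \<inter> snd p -` fst q, snd q \<circ> snd p))"
  show "packs H K C"
  proof (rule packsI[of "c ` (P \<times> Q)"])
    show "finite (c ` (P \<times> Q))" using P(1) Q(1) by simp
    fix a assume "a \<in> c ` (P \<times> Q)"
    then obtain p q where a: "a = c (p, q)" "p \<in> P" "q \<in> Q" by blast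
    have fst_a: "fst a = fst p \<inter> snd p -` fst q" and snd_a: "snd a = snd q \<circ> snd p"
      by (simp_all add: a(1) c_def)
    show "open (fst a)"
      unfolding fst_a using P(2)[OF a(2)] Q(2)[OF a(3)] cont[OF P(3)[OF a(2)]]
      by (simp add: open_Int open_vimage)
    show "snd a \<in> H" unfolding snd_a using P(3)[OF a(2)] Q(3)[OF a(3)] by (rule comp)
    show "inj_on (snd a) (fst a)"
      unfolding fst_a snd_a using P(4)[OF a(2)] Q(4)[OF a(3)] by (auto simp: inj_on_def)
    show "snd a ` fst a \<subseteq> C"
      unfolding fst_a snd_a using Q(5)[OF a(3)] by auto
    fix b assume "b \<in> c ` (P \<times> Q)" and ab: "a \<noteq> b"
    then obtain p' q' where b: "b = c (p', q')" "p' \<in> P" "q' \<in> Q" by blast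
    have fst_b: "fst b = fst p' \<inter> snd p' -` fst q'" and snd_b: "snd b = snd q' \<circ> snd p'"
      by (simp_all add: b(1) c_def)
    show "snd a ` fst a \<inter> snd b ` fst b = {}"
    proof (rule ccontr)
      assume "snd a ` fst a \<inter> snd b ` fst b \<noteq> {}"
      then obtain x y where x: "x \<in> fst p" "snd p x \<in> fst q" and y: "y \<in> fst p'" "snd p' y \<in> fst q'"
        and eq: "snd q (snd p x) = snd q' (snd p' y)"
        unfolding fst_a snd_a fst_b snd_b by auto
      have qq: "q = q'"
        using Q(7)[OF a(3) b(3)] x(2) y(2) eq by blast
      have "snd p x = snd p' y"
        using eq x(2) y(2) Q(4)[OF a(3)] unfolding qq by (auto dest: inj_onD)
      then have "p = p'"
        using P(7)[OF a(2) b(2)] x(1) y(1) by blast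
      then show False using ab qq a(1) b(1) by simp
    qed
  next
    show "K \<subseteq> (\<Union>p\<in>c ` (P \<times> Q). fst p)"
    proof
      fix x assume x: "x \<in> K"
      then obtain p where p: "p \<in> P" "x \<in> W p" using W(3) by blast
      then have "snd p x \<in> L" unfolding L_def using x closure_subset by blast
      then obtain q where q: "q \<in> Q" "snd p x \<in> fst q" using Q(6) by blast
      have "x \<in> fst p" using W(2) p closure_subset by blast
      then have "x \<in> fst (c (p, q))" using q(2) by (simp add: c_def)
      then show "x \<in> (\<Union>p\<in>c ` (P \<times> Q). fst p)" using p(1) q(1) by blast
    qed
  qed
qed

section \<open>Dynamical subequivalence as a preorder on multisets of open sets\<close>

locale topological_action =
  fixes G :: "('g, 'b) monoid_scheme" (structure) and \<alpha> :: "'g \<Rightarrow> 'x::metric_space \<Rightarrow> 'x"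
  assumes grp: "group G" and act: "continuous_action G \<alpha>" and cpt: "compact (UNIV :: 'x set)"
begin

lemma act_mult: "g \<in> carrier G \<Longrightarrow> h \<in> carrier G \<Longrightarrow> \<alpha> (g \<otimes> h) x = \<alpha> g (\<alpha> h x)"
  using act group_action.composition_rule[of G UNIV \<alpha> x g h] by (simp add: continuous_action_def)

lemma act_one: "\<alpha> \<one> x = x"
  using act group_action.id_eq_one[of G UNIV \<alpha>] by (simp add: continuous_action_def fun_eq_iff)

lemma one_in: "\<one> \<in> carrier G" and mult_in: "g \<in> carrier G \<Longrightarrow> h \<in> carrier G \<Longrightarrow> g \<otimes> h \<in> carrier G"
  and inv_in: "g \<in> carrier G \<Longrightarrow> inv g \<in> carrier G"
  using group.inv_closed[OF grp] monoid.one_closed[OF group.is_monoid[OF grp]]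
    monoid.m_closed[OF group.is_monoid[OF grp]] by blast+

lemma act_inv: "g \<in> carrier G \<Longrightarrow> \<alpha> (inv g) (\<alpha> g x) = x"
  "g \<in> carrier G \<Longrightarrow> \<alpha> g (\<alpha> (inv g) x) = x"
  using act_mult[of "inv g" g x] act_mult[of g "inv g" x] grp
  by (simp_all add: group.l_inv group.r_inv inv_in act_one)

lemma inj_act: "g \<in> carrier G \<Longrightarrow> inj (\<alpha> g)"
  by (rule inj_on_inverseI[of _ "\<alpha> (inv g)"]) (rule act_inv(1))

lemma act_image: "g \<in> carrier G \<Longrightarrow> \<alpha> g ` S = \<alpha> (inv g) -` S"
proof (rule Set.set_eqI)
  fix y assume g: "g \<in> carrier G"
  show "y \<in> \<alpha> g ` S \<longleftrightarrow> y \<in> \<alpha> (inv g) -` S"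
  proof
    assume "y \<in> \<alpha> g ` S"
    then show "y \<in> \<alpha> (inv g) -` S" using act_inv(1)[OF g] by auto
  next
    assume "y \<in> \<alpha> (inv g) -` S"
    then have "\<alpha> g (\<alpha> (inv g) y) \<in> \<alpha> g ` S" by blast
    then show "y \<in> \<alpha> g ` S" by (simp only: act_inv(2)[OF g])
  qed
qed

lemma continuous_act:
  assumes "g \<in> carrier G"
  shows "continuous_on UNIV (\<alpha> g)"
proof -
  have "continuous_map euclidean (prod_topology (discrete_topology (carrier G)) euclidean) (\<lambda>x::'x. (g, x))"
    using assms by (simp add: continuous_map_pairwise o_def)
  then have "continuous_map euclidean euclidean ((\<lambda>(g, x). \<alpha> g x) \<circ> (\<lambda>x. (g, x)))"
    using act unfolding continuous_action_def by (elim conjE) (rule continuous_map_compose)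
  then show ?thesis by (simp add: o_def)
qed

lemma open_act_vimage: "g \<in> carrier G \<Longrightarrow> open S \<Longrightarrow> open (\<alpha> g -` S)"
  by (rule open_vimage[OF _ continuous_act])

lemma open_act_image: "g \<in> carrier G \<Longrightarrow> open S \<Longrightarrow> open (\<alpha> g ` S)"
  by (simp add: act_image inv_in open_act_vimage)

text \<open>
  A list of open sets is viewed as one open subset of \<open>X \<times> \<nat>\<close>, its stack, with the \<open>i\<close>-th entry over
  \<open>i\<close>. A piece with translation \<open>g\<close> and target index \<open>k\<close> is then moved by a single map, and \<open>\<prec>\<close> for
  lists becomes the relation between two sets considered above.
\<close>

definition moves :: "('x \<times> nat \<Rightarrow> 'x \<times> nat) set"
  where "moves = {map_prod (\<alpha> g) \<sigma> | g \<sigma>. g \<in> carrier G}"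

text \<open>
  Interiors are taken so that every list of sets, and not just every list of open sets, gives an open
  stack. The monoid of all finite multisets of sets is then available, with no openness condition on
  its elements.
\<close>

definition stack :: "'x set list \<Rightarrow> ('x \<times> nat) set"
  where "stack l = (\<Union>i<length l. interior (l ! i) \<times> {i})"

lemma in_stack: "(x, i) \<in> stack l \<longleftrightarrow> i < length l \<and> x \<in> interior (l ! i)"
  by (auto simp: stack_def)

lemma open_stack: "open (stack l)"
  unfolding stack_def by (intro open_UN ballI open_Times open_interior open_discrete)

lemma movesI: "g \<in> carrier G \<Longrightarrow> map_prod (\<alpha> g) \<sigma> \<in> moves"
  unfolding moves_def by blast

lemma continuous_moves:
  assumes "h \<in> moves" shows "continuous_on UNIV h"
proof -
  obtain g \<sigma> where h: "h = map_prod (\<alpha> g) \<sigma>" and g: "g \<in> carrier G"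
    using assms unfolding moves_def by blast
  have "continuous_on UNIV (\<lambda>p :: 'x \<times> nat. (\<alpha> g (fst p), \<sigma> (snd p)))"
  proof (rule continuous_on_Pair)
    show "continuous_on UNIV (\<lambda>p :: 'x \<times> nat. \<alpha> g (fst p))"
      by (rule continuous_on_compose2[OF continuous_act[OF g] continuous_on_fst[OF continuous_on_id]]) simp
    show "continuous_on UNIV (\<lambda>p :: 'x \<times> nat. \<sigma> (snd p))"
      by (rule continuous_on_compose2[OF _ continuous_on_snd[OF continuous_on_id], of UNIV \<sigma>]) simp_all
  qed
  then show ?thesis by (simp add: h map_prod_def case_prod_unfold)
qed

lemma moves_comp:
  assumes "h \<in> moves" "h' \<in> moves" shows "h' \<circ> h \<in> moves"
proof -
  obtain g \<sigma> where h: "h = map_prod (\<alpha> g) \<sigma>" and g: "g \<in> carrier G"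
    using assms unfolding moves_def by blast
  obtain g' \<sigma>' where h': "h' = map_prod (\<alpha> g') \<sigma>'" and g': "g' \<in> carrier G"
    using assms unfolding moves_def by blast
  have "h' \<circ> h = map_prod (\<alpha> (g' \<otimes> g)) (\<sigma>' \<circ> \<sigma>)"
    using g g' by (auto simp: h h' fun_eq_iff act_mult)
  then show ?thesis using movesI g g' mult_in by simp
qed

lemma below_moves_trans: "below moves A B \<Longrightarrow> below moves B C \<Longrightarrow> below moves A C"
  by (rule below_trans[of moves A B C]) (assumption | erule continuous_moves | erule (1) moves_comp)+

lemma below_relabel:
  assumes "open A" "inj_on \<sigma> (snd ` A)" "\<And>x i. (x, i) \<in> A \<Longrightarrow> (x, \<sigma> i) \<in> B"
  shows "below moves A B"
proof (rule below_single[OF assms(1) movesI[OF one_in, of \<sigma>]])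
  show "inj_on (map_prod (\<alpha> \<one>) \<sigma>) A"
    using assms(2) by (fastforce simp: inj_on_def act_one)
  show "map_prod (\<alpha> \<one>) \<sigma> ` A \<subseteq> B"
    using assms(3) by (auto simp: act_one)
qed

lemma below_slice:
  assumes "open U" "g \<in> carrier G" "\<alpha> g ` U \<subseteq> V"
  shows "below moves (U \<times> {i}) (V \<times> {j})"
proof (rule below_single[OF _ movesI[OF assms(2), of "\<lambda>_. j"]])
  show "open (U \<times> {i})" using assms(1) by (simp add: open_Times open_discrete)
  show "inj_on (map_prod (\<alpha> g) (\<lambda>_. j)) (U \<times> {i})"
    using inj_act[OF assms(2)] by (auto simp: inj_on_def)
  show "map_prod (\<alpha> g) (\<lambda>_. j) ` (U \<times> {i}) \<subseteq> V \<times> {j}"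
    using assms(3) by auto
qed

lemma below_stack_permute:
  assumes "mset k = mset l"
  shows "below moves (stack k) (stack l)"
proof -
  obtain p where p: "p permutes {..<length l}" "permute_list p l = k"
    using mset_eq_permutation[OF assms] .
  have nth: "k ! i = l ! p i" "p i < length l" if "i < length k" for i
    using p that permute_list_nth[OF p(1), of i] permutes_in_image[OF p(1), of i] by auto
  show ?thesis
    by (rule below_relabel[OF open_stack, of p])
      (use nth permutes_inj[OF p(1)] in \<open>auto simp: in_stack inj_on_def inj_def\<close>)
qed

text \<open>
  The appended copies of \<open>p\<close> sit at different heights on the two sides, and are matched by a change of
  index.
\<close>

lemma below_stack_append:
  assumes "below moves (stack k) (stack l)"
  shows "below moves (stack (k @ p)) (stack (l @ p))"
proof -
  define T where "T m = (\<Union>i<length p. interior (p ! i) \<times> {m + i})" for m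
  have T: "(x, j) \<in> T m \<longleftrightarrow> (\<exists>i<length p. x \<in> interior (p ! i) \<and> j = m + i)" for x j m
    by (auto simp: T_def)
  have split: "stack (l @ p) = stack l \<union> T (length l)" for l
  proof (rule Set.set_eqI)
    fix z :: "'x \<times> nat"
    obtain x i where z: "z = (x, i)" by (cases z)
    show "z \<in> stack (l @ p) \<longleftrightarrow> z \<in> stack l \<union> T (length l)"
    proof (cases "i < length l")
      case True
      then show ?thesis by (simp add: z in_stack T nth_append)
    next
      case False
      then obtain m where "i = length l + m" using le_Suc_ex not_less by blast
      then show ?thesis by (simp add: z in_stack T nth_append conj_commute)
    qed
  qed
  have open_T: "open (T m)" for m
    unfolding T_def by (intro open_UN ballI open_Times open_interior open_discrete)
  have "below moves (T (length k)) (T (length l))"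
    by (rule below_relabel[OF open_T, of "\<lambda>i. i - length k + length l"])
      (auto simp: T inj_on_def)
  moreover have "stack l \<inter> T (length l) = {}" by (auto simp: in_stack T)
  ultimately show ?thesis
    unfolding split using assms by (intro below_Un open_stack open_T)
qed

text \<open>
  Subequivalence does not depend on the order of a list, which makes it a relation on multisets.
\<close>

definition mset_below :: "'x set multiset \<Rightarrow> 'x set multiset \<Rightarrow> bool"
  where "mset_below M N \<longleftrightarrow> (\<exists>k l. mset k = M \<and> mset l = N \<and> below moves (stack k) (stack l))"

lemma mset_belowI: "below moves (stack k) (stack l) \<Longrightarrow> mset_below (mset k) (mset l)"
  unfolding mset_below_def by blast

lemma mset_belowD:
  assumes "mset_below (mset k) (mset l)" shows "below moves (stack k) (stack l)"
proof -
  obtain k' l' where "mset k' = mset k" "mset l' = mset l" "below moves (stack k') (stack l')"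
    using assms unfolding mset_below_def by blast
  then show ?thesis by (metis below_stack_permute below_moves_trans)
qed

sublocale preordered_multisets mset_below
proof
  fix x y z :: "'x set multiset"
  obtain k l p where k: "mset k = x" and l: "mset l = y" and p: "mset p = z"
    by (metis ex_mset)
  show "mset_below x x" unfolding k[symmetric] by (intro mset_belowI below_stack_permute) simp
  show "mset_below x z" if "mset_below x y" "mset_below y z"
    using that unfolding k[symmetric] l[symmetric] p[symmetric]
    by (blast intro: mset_belowI mset_belowD below_moves_trans)
  show "mset_below (x + z) (y + z)" if "mset_below x y"
    using that mset_belowI[OF below_stack_append[OF mset_belowD, of k l p]]
    unfolding k[symmetric] l[symmetric] p[symmetric] by simp
  show "mset_below {#} x"
    using mset_belowI[of "[]" k] by (simp add: stack_def below_empty k)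
qed

lemma stack_single: "open U \<Longrightarrow> stack [U] = U \<times> {0}"
  and stack_two: "open U \<Longrightarrow> open V \<Longrightarrow> stack [U, V] = U \<times> {0} \<union> V \<times> {1}"
  by (auto simp: stack_def interior_open lessThan_Suc)

text \<open>
  This relation and the next three make a state invariant, monotone, subadditive and superadditive on
  disjoint sets when it is restricted to single open sets.
\<close>

lemma mset_below_translate:
  assumes "g \<in> carrier G" "open U" "open V" "\<alpha> g ` U \<subseteq> V"
  shows "mset_below {#U#} {#V#}"
  using mset_belowI[of "[U]" "[V]"] assms by (simp add: stack_single below_slice)

lemma mset_below_mono:
  assumes "U \<subseteq> V"
  shows "mset_below {#U#} {#V#}"
proof -
  have "below moves (stack [U]) (stack [V])"
    by (rule below_relabel[OF open_stack, of id]) (use interior_mono[OF assms] in \<open>auto simp: in_stack\<close>)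
  then show ?thesis using mset_belowI[of "[U]" "[V]"] by simp
qed

lemma mset_below_Un:
  assumes "open U" "open V"
  shows "mset_below {#U \<union> V#} {#U, V#}"
proof -
  have "below moves (U \<times> {0} \<union> V \<times> {0}) (U \<times> {0} \<union> V \<times> {1})"
    using assms one_in by (intro below_Un below_slice open_Times open_discrete) (auto simp: act_one)
  moreover have "(U \<union> V) \<times> {0::nat} = U \<times> {0} \<union> V \<times> {0}" by blast
  ultimately show ?thesis
    using assms mset_belowI[of "[U \<union> V]" "[U, V]"] by (simp add: stack_single stack_two open_Un)
qed

lemma mset_below_disjoint_Un:
  assumes "open U" "open V" "U \<inter> V = {}"
  shows "mset_below {#U, V#} {#U \<union> V#}"
proof -
  have "below moves (U \<times> {0} \<union> V \<times> {1}) (U \<times> {0} \<union> V \<times> {0})"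
    using assms one_in by (intro below_Un below_slice open_Times open_discrete) (auto simp: act_one)
  moreover have "(U \<union> V) \<times> {0::nat} = U \<times> {0} \<union> V \<times> {0}" by blast
  ultimately show ?thesis
    using assms mset_belowI[of "[U, V]" "[U \<union> V]"] by (simp add: stack_single stack_two open_Un)
qed

text \<open>
  By compactness finitely many translates of \<open>W\<close> cover the space, so the whole space lies below a
  multiple of \<open>W\<close>, and so does every multiset.
\<close>

lemma order_unit:
  assumes "open W" and meets: "\<And>x. \<exists>g\<in>carrier G. \<alpha> g x \<in> W"
  shows "\<exists>n. mset_below M (repeat_mset n {#W#})"
proof -
  have finite_cover: "\<exists>n. mset_below {#\<Union>g\<in>T. \<alpha> g -` W#} (repeat_mset n {#W#})"
    if "finite T" "T \<subseteq> carrier G" for T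
    using that
  proof (induction T)
    case empty
    have "mset_below {#{}#} {#}"
      using mset_belowI[of "[{}]" "[]"] by (simp add: stack_def below_empty)
    then show ?case by (auto intro: exI[of _ 0])
  next
    case (insert g T)
    then obtain n where n: "mset_below {#\<Union>g\<in>T. \<alpha> g -` W#} (repeat_mset n {#W#})" by auto
    have g: "g \<in> carrier G" "T \<subseteq> carrier G" using insert.prems by auto
    have op: "open (\<alpha> g -` W)" "open (\<Union>g\<in>T. \<alpha> g -` W)"
      using g \<open>open W\<close> open_act_vimage by auto
    have "mset_below {#\<Union>g\<in>insert g T. \<alpha> g -` W#} ({#\<alpha> g -` W#} + {#\<Union>g\<in>T. \<alpha> g -` W#})"
      using mset_below_Un[OF op] by (simp add: add_mset_commute)
    also have "mset_below \<dots> ({#W#} + repeat_mset n {#W#})"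
      using g op \<open>open W\<close> by (intro le_add n mset_below_translate[of g]) auto
    finally have "mset_below {#\<Union>g\<in>insert g T. \<alpha> g -` W#} (repeat_mset (Suc n) {#W#})" by simp
    then show ?case by blast
  qed
  have "\<exists>n. mset_below {#UNIV#} (repeat_mset n {#W#})"
  proof -
    have op: "open (\<alpha> g -` W)" if "g \<in> carrier G" for g
      using that \<open>open W\<close> by (rule open_act_vimage)
    have "(UNIV :: 'x set) \<subseteq> (\<Union>g\<in>carrier G. \<alpha> g -` W)" using meets by auto
    from compactE_image[OF cpt op this]
    obtain T where T: "T \<subseteq> carrier G" "finite T" "(UNIV :: 'x set) \<subseteq> (\<Union>g\<in>T. \<alpha> g -` W)"
      by blast
    have "(\<Union>g\<in>T. \<alpha> g -` W) = UNIV" using T(3) by blast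
    then show ?thesis using finite_cover[OF T(2,1)] by simp
  qed
  then obtain m where m: "mset_below {#UNIV#} (repeat_mset m {#W#})" by blast
  show ?thesis
  proof (induction M)
    case empty
    show ?case using le_zero by blast
  next
    case (add U M)
    then obtain n where n: "mset_below M (repeat_mset n {#W#})" by blast
    have "mset_below {#U#} (repeat_mset m {#W#})"
      using mset_below_mono[of U UNIV] m by (blast intro: le_trans)
    from le_add[OF this n] have "mset_below ({#U#} + M) (repeat_mset (m + n) {#W#})"
      unfolding repeat_mset_distrib .
    then have "mset_below (add_mset U M) (repeat_mset (m + n) {#W#})" by simp
    then show ?case by blast
  qed
qed

text \<open>
  A packing of one stack into another is cut along the heights of the source. Cuts that are empty are
  left out, as their target index could be out of range.
\<close>

lemma dyn_subequivalent_if_below: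
  assumes os: "\<And>i. i < length Os \<Longrightarrow> open (Os ! i)"
    and below: "below moves (stack Os) (stack Vs)"
  shows "dyn_subequivalent G \<alpha> Os Vs"
  unfolding dyn_subequivalent_def
proof (intro allI impI)
  fix F :: "nat \<Rightarrow> 'x set" assume F: "\<forall>i<length Os. closed (F i) \<and> F i \<subseteq> Os ! i"
  define K where "K = (\<Union>i<length Os. F i \<times> {i})"
  have "compact (F i)" if "i < length Os" for i
    using compact_Int_closed[OF cpt, of "F i"] F that by simp
  then have "compact K"
    unfolding K_def by (intro compact_UN compact_Times) auto
  moreover have "K \<subseteq> stack Os"
  proof
    fix z assume "z \<in> K"
    then obtain x i where z: "z = (x, i)" "i < length Os" "x \<in> F i" unfolding K_def by blast
    then show "z \<in> stack Os" using F os[OF z(2)] by (auto simp: in_stack interior_open)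
  qed
  ultimately have pK: "packs moves K (stack Vs)" by (rule belowD[OF below])
  obtain P where P0: "finite P"
    "\<forall>p\<in>P. open (fst p)" "\<forall>p\<in>P. snd p \<in> moves"
    "\<forall>p\<in>P. inj_on (snd p) (fst p)" "\<forall>p\<in>P. snd p ` fst p \<subseteq> stack Vs"
    "K \<subseteq> (\<Union>p\<in>P. fst p)"
    "\<forall>p\<in>P. \<forall>q\<in>P. p \<noteq> q \<longrightarrow> snd p ` fst p \<inter> snd q ` fst q = {}"
    by (rule packsE[OF pK])
  note P = P0[rule_format]
  have "\<forall>p\<in>P. \<exists>g. \<exists>\<sigma>. g \<in> carrier G \<and> snd p = map_prod (\<alpha> g) \<sigma>"
    using P(3) unfolding moves_def by blast
  then obtain g where "\<forall>p\<in>P. \<exists>\<sigma>. g p \<in> carrier G \<and> snd p = map_prod (\<alpha> (g p)) \<sigma>"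
    by (rule bchoice[THEN exE])
  then obtain \<sigma> where g\<sigma>: "\<forall>p\<in>P. g p \<in> carrier G \<and> snd p = map_prod (\<alpha> (g p)) (\<sigma> p)"
    by (rule bchoice[THEN exE])
  define slice where "slice p i = {x. (x, i) \<in> fst p}" for p :: "('x \<times> nat) set \<times> ('x \<times> nat \<Rightarrow> 'x \<times> nat)" and i
  have "\<exists>ps. set ps = {p\<in>P. slice p i \<noteq> {}} \<and> distinct ps" for i
    using P(1) by (intro finite_distinct_list) simp
  then obtain ps where ps: "\<And>i. set (ps i) = {p\<in>P. slice p i \<noteq> {}}" "\<And>i. distinct (ps i)"
    by metis
  have nth: "ps i ! j \<in> P" "slice (ps i ! j) i \<noteq> {}" if "j < length (ps i)" for i j
    using nth_mem[OF that] ps(1)[of i] by auto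
  have move: "snd p (x, i) = (\<alpha> (g p) x, \<sigma> p i)" if "p \<in> P" for p x i
    using g\<sigma> that by simp
  let ?U = "\<lambda>i j. slice (ps i ! j) i" and ?s = "\<lambda>i j. g (ps i ! j)" and ?k = "\<lambda>i j. \<sigma> (ps i ! j) i"
  have target: "(\<alpha> (?s i j) x, ?k i j) \<in> stack Vs" if "j < length (ps i)" "x \<in> ?U i j" for i j x
  proof -
    have "snd (ps i ! j) (x, i) \<in> stack Vs"
      using P(5)[OF nth(1)[OF that(1)]] that(2) unfolding slice_def by blast
    then show ?thesis by (simp only: move[OF nth(1)[OF that(1)]])
  qed
  show "\<exists>(J :: nat \<Rightarrow> nat) (U :: nat \<Rightarrow> nat \<Rightarrow> 'x set) (s :: nat \<Rightarrow> nat \<Rightarrow> 'g) (k :: nat \<Rightarrow> nat \<Rightarrow> nat).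
           (\<forall>i < length Os.
              F i \<subseteq> (\<Union>j<J i. U i j) \<and>
              (\<forall>j < J i.
                 open (U i j) \<and> s i j \<in> carrier G \<and> k i j < length Vs \<and>
                 (\<alpha> (s i j) ` U i j) \<times> {k i j} \<subseteq> (\<Union>l<length Vs. (Vs ! l) \<times> {l}))) \<and>
           disjoint_family_on (\<lambda>(i, j). (\<alpha> (s i j) ` U i j) \<times> {k i j})
             (SIGMA i:{..<length Os}. {..<J i})"
  proof (intro exI[of _ "\<lambda>i. length (ps i)"] exI[of _ ?U] exI[of _ ?s] exI[of _ ?k] conjI allI impI)
    fix i assume i: "i < length Os"
    show "F i \<subseteq> (\<Union>j<length (ps i). ?U i j)"
    proof
      fix x assume "x \<in> F i"
      then have "(x, i) \<in> K" using i unfolding K_def by blast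
      then obtain p where p: "p \<in> P" "(x, i) \<in> fst p" using P(6) by blast
      then have x: "x \<in> slice p i" and "p \<in> set (ps i)" by (auto simp: slice_def ps(1))
      then obtain j where "j < length (ps i)" "ps i ! j = p" by (auto simp: in_set_conv_nth)
      then show "x \<in> (\<Union>j<length (ps i). ?U i j)" using x by blast
    qed
    fix j assume j: "j < length (ps i)"
    have "open ((\<lambda>x. (x, i)) -` fst (ps i ! j))"
      using P(2)[OF nth(1)[OF j]] by (intro open_vimage continuous_intros)
    then show "open (?U i j)" by (simp add: slice_def vimage_def)
    show "?s i j \<in> carrier G" using g\<sigma> nth(1)[OF j] by blast
    obtain x where "x \<in> ?U i j" using nth(2)[OF j] by blast
    then show "?k i j < length Vs" using target[OF j] in_stack by blast
    show "\<alpha> (?s i j) ` ?U i j \<times> {?k i j} \<subseteq> (\<Union>l<length Vs. (Vs ! l) \<times> {l})"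
      using target[OF j] interior_subset by (auto simp: in_stack)
  next
    show "disjoint_family_on (\<lambda>(i, j). \<alpha> (?s i j) ` ?U i j \<times> {?k i j})
        (SIGMA i:{..<length Os}. {..<length (ps i)})"
      unfolding disjoint_family_on_def
    proof (intro ballI impI)
      fix a b
      assume a: "a \<in> (SIGMA i:{..<length Os}. {..<length (ps i)})"
        and b: "b \<in> (SIGMA i:{..<length Os}. {..<length (ps i)})" and ab: "a \<noteq> b"
      obtain i j where aij: "a = (i, j)" by (cases a)
      obtain i' j' where bij: "b = (i', j')" by (cases b)
      have j: "j < length (ps i)" and j': "j' < length (ps i')"
        using a b unfolding aij bij by auto
      have ne: "i = i' \<longrightarrow> j \<noteq> j'" using ab unfolding aij bij by simp
      have "\<alpha> (?s i j) ` ?U i j \<times> {?k i j} \<inter> \<alpha> (?s i' j') ` ?U i' j' \<times> {?k i' j'} = {}"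
      proof (rule ccontr)
        assume "\<alpha> (?s i j) ` ?U i j \<times> {?k i j} \<inter> \<alpha> (?s i' j') ` ?U i' j' \<times> {?k i' j'} \<noteq> {}"
        then obtain x y where x: "x \<in> ?U i j" and y: "y \<in> ?U i' j'"
          and eq: "\<alpha> (?s i j) x = \<alpha> (?s i' j') y" "?k i j = ?k i' j'" by auto
        have eq': "snd (ps i ! j) (x, i) = snd (ps i' ! j') (y, i')"
          by (simp only: move[OF nth(1)[OF j]] move[OF nth(1)[OF j']] eq)
        have same: "ps i ! j = ps i' ! j'"
          using P(7)[OF nth(1)[OF j] nth(1)[OF j']] x y eq' unfolding slice_def by blast
        then have "(x, i) = (y, i')"
          using P(4)[OF nth(1)[OF j]] x y eq' unfolding slice_def by (auto dest: inj_onD)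
        then show False
          using same ne ps(2)[of i] j j' nth_eq_iff_index_eq by auto
      qed
      then show "(\<lambda>(i, j). \<alpha> (?s i j) ` ?U i j \<times> {?k i j}) a
          \<inter> (\<lambda>(i, j). \<alpha> (?s i j) ` ?U i j \<times> {?k i j}) b = {}"
        unfolding aij bij by simp
    qed
  qed
qed

lemma dyn_subequivalent_if_mset_below:
  assumes "open A" "mset_below (repeat_mset m {#A#}) (repeat_mset n {#B#})"
  shows "dyn_subequivalent G \<alpha> (replicate m A) (replicate n B)"
  using assms by (intro dyn_subequivalent_if_below mset_belowD) simp_all

end

section \<open>Regular measures from contents on open sets\<close>

text \<open>
  What a state provides on open sets. Such a content need not be continuous along increasing unions, so
  it is not yet the restriction of a measure.
\<close>

locale open_content =
  fixes d :: "'x::metric_space set \<Rightarrow> real"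
  assumes space_compact: "compact (UNIV :: 'x set)"
    and nonneg: "\<And>U. open U \<Longrightarrow> 0 \<le> d U"
    and mono: "\<And>U V. open U \<Longrightarrow> open V \<Longrightarrow> U \<subseteq> V \<Longrightarrow> d U \<le> d V"
    and subadd: "\<And>U V. open U \<Longrightarrow> open V \<Longrightarrow> d (U \<union> V) \<le> d U + d V"
    and superadd: "\<And>U V. open U \<Longrightarrow> open V \<Longrightarrow> U \<inter> V = {} \<Longrightarrow> d U + d V \<le> d (U \<union> V)"
    and total: "d UNIV = 1"
begin

text \<open>
  The inner regularization, which is what makes the content countably subadditive.
\<close>

definition inner_content :: "'x set \<Rightarrow> ennreal"
  where "inner_content U = (SUP W\<in>{W. open W \<and> closure W \<subseteq> U}. ennreal (d W))"

definition outer_content :: "'x set \<Rightarrow> ennreal"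
  where "outer_content E = (INF U\<in>{U. open U \<and> E \<subseteq> U}. inner_content U)"

lemma d_empty: "d {} = 0"
  using superadd[of "{}" "{}"] nonneg[of "{}"] by simp

lemma le_inner: "open W \<Longrightarrow> closure W \<subseteq> U \<Longrightarrow> ennreal (d W) \<le> inner_content U"
  unfolding inner_content_def by (rule SUP_upper) simp

lemma inner_le: "(\<And>W. open W \<Longrightarrow> closure W \<subseteq> U \<Longrightarrow> ennreal (d W) \<le> c) \<Longrightarrow> inner_content U \<le> c"
  unfolding inner_content_def by (rule SUP_least) simp

lemma inner_le_d:
  assumes "open U" shows "inner_content U \<le> ennreal (d U)"
proof (rule inner_le)
  fix W assume "open W" "closure W \<subseteq> U"
  moreover then have "W \<subseteq> U" using closure_subset[of W] by blast
  ultimately show "ennreal (d W) \<le> ennreal (d U)" using assms by (intro ennreal_leI mono)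
qed

lemma inner_mono: "U \<subseteq> V \<Longrightarrow> inner_content U \<le> inner_content V"
  by (intro inner_le le_inner) auto

lemma outer_le: "open U \<Longrightarrow> E \<subseteq> U \<Longrightarrow> outer_content E \<le> inner_content U"
  unfolding outer_content_def by (rule INF_lower) simp

lemma le_outer: "(\<And>U. open U \<Longrightarrow> E \<subseteq> U \<Longrightarrow> c \<le> inner_content U) \<Longrightarrow> c \<le> outer_content E"
  unfolding outer_content_def by (rule INF_greatest) simp

lemma outer_open: "open U \<Longrightarrow> outer_content U = inner_content U"
  by (intro antisym outer_le le_outer inner_mono) auto

lemma outer_mono: "E \<subseteq> E' \<Longrightarrow> outer_content E \<le> outer_content E'"
  by (intro le_outer outer_le) auto

lemma outer_UNIV: "outer_content UNIV = 1"
proof (rule antisym)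
  show "outer_content UNIV \<le> 1" using inner_le_d[of UNIV] by (simp add: outer_open total)
  show "1 \<le> outer_content UNIV" using le_inner[of UNIV UNIV] by (simp add: outer_open total)
qed

lemma outer_le_1: "outer_content E \<le> 1"
  using outer_mono[of E UNIV] by (simp add: outer_UNIV)

lemma d_finite_Union:
  assumes "finite T" "\<And>i. i \<in> T \<Longrightarrow> open (W i)"
  shows "d (\<Union>i\<in>T. W i) \<le> (\<Sum>i\<in>T. d (W i))"
  using assms
proof (induction T)
  case empty
  then show ?case by (simp add: d_empty)
next
  case (insert i T)
  have "d (W i \<union> (\<Union>i\<in>T. W i)) \<le> d (W i) + d (\<Union>i\<in>T. W i)"
    using insert.prems by (intro subadd open_UN) auto
  also have "d (\<Union>i\<in>T. W i) \<le> (\<Sum>i\<in>T. d (W i))" using insert.prems by (intro insert.IH) simp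
  finally show ?case using insert.hyps by simp
qed

text \<open>
  A set whose closure lies in the union is covered by finitely many of the \<open>V i\<close>, slightly shrunk, so
  that finite subadditivity of \<open>d\<close> suffices.
\<close>

lemma inner_countably_subadditive:
  fixes V :: "nat \<Rightarrow> 'x set"
  assumes V: "\<And>i. open (V i)"
  shows "inner_content (\<Union>i. V i) \<le> (\<Sum>i. inner_content (V i))"
proof (rule inner_le)
  fix W assume W: "open W" "closure W \<subseteq> (\<Union>i. V i)"
  have K: "compact (closure W)"
    using compact_Int_closed[OF space_compact, of "closure W"] by simp
  obtain W' where W0: "\<forall>i. open (W' i)" "\<forall>i\<in>UNIV. closure (W' i) \<subseteq> V i" "closure W \<subseteq> (\<Union>i. W' i)"
    by (rule compact_shrinking[OF K V W(2)])
  have op: "open (W' i)" for i using W0(1) by blast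
  obtain T where T: "T \<subseteq> UNIV" "finite T" "closure W \<subseteq> (\<Union>i\<in>T. W' i)"
    by (rule compactE_image[OF K op W0(3)])
  have "d W \<le> d (\<Union>i\<in>T. W' i)"
    by (intro mono open_UN ballI op W(1) order_trans[OF closure_subset T(3)])
  also have "\<dots> \<le> (\<Sum>i\<in>T. d (W' i))" using T(2) op by (rule d_finite_Union)
  finally have "ennreal (d W) \<le> ennreal (\<Sum>i\<in>T. d (W' i))" by (rule ennreal_leI)
  also have "\<dots> = (\<Sum>i\<in>T. ennreal (d (W' i)))"
    by (intro sum_ennreal[symmetric] nonneg op)
  also have "\<dots> \<le> (\<Sum>i\<in>T. inner_content (V i))"
    by (intro sum_mono le_inner op W0(2)[rule_format] UNIV_I)
  also have "\<dots> \<le> (\<Sum>i. inner_content (V i))" using T(2) by (intro sum_le_suminf) auto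
  finally show "ennreal (d W) \<le> (\<Sum>i. inner_content (V i))" .
qed

lemma outer_countably_subadditive:
  fixes E :: "nat \<Rightarrow> 'x set"
  shows "outer_content (\<Union>i. E i) \<le> (\<Sum>i. outer_content (E i))"
proof (rule ennreal_le_epsilon)
  fix e :: real assume e: "0 < e"
  have "\<exists>U. open U \<and> E i \<subseteq> U \<and> inner_content U \<le> outer_content (E i) + ennreal (e * (1/2) ^ Suc i)" for i
  proof -
    have "outer_content (E i) < \<infinity>" using outer_le_1[of "E i"] by (rule le_less_trans) simp
    then have "outer_content (E i) \<noteq> \<infinity>" by simp
    moreover have "0 < e * (1/2) ^ Suc i" using e by simp
    ultimately have "\<exists>U\<in>{U. open U \<and> E i \<subseteq> U}. inner_content U < outer_content (E i) + ennreal (e * (1/2) ^ Suc i)"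
      by (intro INF_approx_ennreal outer_content_def)
    then show ?thesis by (auto intro: less_imp_le)
  qed
  then obtain U where U: "\<And>i. open (U i)" "\<And>i. E i \<subseteq> U i"
    "\<And>i. inner_content (U i) \<le> outer_content (E i) + ennreal (e * (1/2) ^ Suc i)" by metis
  have "outer_content (\<Union>i. E i) \<le> inner_content (\<Union>i. U i)"
    using U(1,2) by (intro outer_le open_UN UN_mono) auto
  also have "\<dots> \<le> (\<Sum>i. inner_content (U i))" using U(1) by (rule inner_countably_subadditive)
  also have "\<dots> \<le> (\<Sum>i. outer_content (E i) + ennreal (e * (1/2) ^ Suc i))"
    using U(3) by (intro suminf_le) auto
  also have "\<dots> = (\<Sum>i. outer_content (E i)) + (\<Sum>i. ennreal (e * (1/2) ^ Suc i))"
    by (intro suminf_add[symmetric]) auto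
  also have "(\<Sum>i. ennreal (e * (1/2) ^ Suc i)) = ennreal e"
    using sums_mult[OF power_half_series, of e] e by (intro suminf_ennreal_eq) auto
  finally show "outer_content (\<Union>i. E i) \<le> (\<Sum>i. outer_content (E i)) + ennreal e" .
qed

lemma outer_empty: "outer_content {} = 0"
proof -
  have "inner_content {} \<le> 0" using inner_le_d[of "{}"] by (simp add: d_empty)
  then show ?thesis using outer_le[of "{}" "{}"] by simp
qed

lemma outer_measure: "outer_measure_space (Pow UNIV) outer_content"
  unfolding outer_measure_space_def positive_def increasing_def countably_subadditive_def
  using outer_empty outer_mono outer_countably_subadditive by auto

lemma outer_disjoint_Un:
  assumes "A \<inter> B = {}" shows "outer_content (A \<union> B) \<le> outer_content A + outer_content B"
proof -
  have "subadditive (Pow UNIV) outer_content"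
    using outer_measure unfolding outer_measure_space_def
    by (intro ring_of_sets.countably_subadditive_subadditive[OF ring_of_sets_Pow]) auto
  then show ?thesis using assms by (simp add: subadditive_def)
qed

text \<open>
  An open set splits every set additively: nearly all of the content of \<open>V \<inter> U\<close> is carried by some
  \<open>W\<close> whose closure lies in \<open>V \<inter> U\<close>, and \<open>V - closure W\<close> is an open set containing \<open>V - U\<close>. Open sets
  inside the two are disjoint, so that superadditivity of \<open>d\<close> applies.
\<close>

lemma open_caratheodory:
  assumes U: "open U"
  shows "outer_content (E \<inter> U) + outer_content (E - U) \<le> outer_content E"
proof (rule le_outer)
  fix V assume V: "open V" "E \<subseteq> V"
  have "outer_content (E \<inter> U) + outer_content (E - U) \<le> inner_content (V \<inter> U) + outer_content (V - U)"
    using U V by (intro add_mono outer_le outer_mono) auto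
  also have "inner_content (V \<inter> U) + outer_content (V - U) =
      (SUP W\<in>{W. open W \<and> closure W \<subseteq> V \<inter> U}. ennreal (d W) + outer_content (V - U))"
    unfolding inner_content_def by (intro ennreal_SUP_add_left[symmetric]) (auto intro: exI[of _ "{}"])
  also have "\<dots> \<le> inner_content V"
  proof (rule SUP_least, clarify)
    fix W assume W: "open W" "closure W \<subseteq> V \<inter> U"
    have "ennreal (d W) + outer_content (V - U) \<le> ennreal (d W) + inner_content (V - closure W)"
      using W V by (intro add_left_mono outer_le) auto
    also have "\<dots> = (SUP W'\<in>{W'. open W' \<and> closure W' \<subseteq> V - closure W}. ennreal (d W) + ennreal (d W'))"
      unfolding inner_content_def by (intro ennreal_SUP_add_right) (auto intro: exI[of _ "{}"])
    also have "\<dots> \<le> inner_content V"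
    proof (rule SUP_least, clarify)
      fix W' assume W': "open W'" "closure W' \<subseteq> V - closure W"
      have "W \<inter> W' = {}" using W' closure_subset[of W] closure_subset[of W'] by blast
      then have "d W + d W' \<le> d (W \<union> W')" using W W' by (intro superadd)
      then have "ennreal (d W) + ennreal (d W') \<le> ennreal (d (W \<union> W'))"
        using W W' nonneg by (simp flip: ennreal_plus add: ennreal_leI)
      also have "\<dots> \<le> inner_content V" using W W' by (intro le_inner) (auto simp: closure_Un)
      finally show "ennreal (d W) + ennreal (d W') \<le> inner_content V" .
    qed
    finally show "ennreal (d W) + outer_content (V - U) \<le> inner_content V" .
  qed
  finally show "outer_content (E \<inter> U) + outer_content (E - U) \<le> inner_content V" .
qed

abbreviation caratheodory_sets :: "'x set set"
  where "caratheodory_sets \<equiv> lambda_system UNIV (Pow UNIV) outer_content"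

lemma caratheodory_measure: "measure_space UNIV caratheodory_sets outer_content"
  by (rule sigma_algebra.caratheodory_lemma[OF sigma_algebra_Pow outer_measure])

lemma borel_subset_caratheodory: "sets borel \<subseteq> caratheodory_sets"
proof -
  have "{S. open S} \<subseteq> caratheodory_sets"
  proof
    fix U :: "'x set" assume "U \<in> {S. open S}"
    then have U: "open U" by simp
    have "outer_content (U \<inter> E) + outer_content (E - U) = outer_content E" for E :: "'x set"
    proof (rule antisym)
      show "outer_content (U \<inter> E) + outer_content (E - U) \<le> outer_content E"
        using open_caratheodory[OF U, of E] by (simp add: Int_commute)
      have "outer_content ((U \<inter> E) \<union> (E - U)) \<le> outer_content (U \<inter> E) + outer_content (E - U)"
        by (rule outer_disjoint_Un) auto
      moreover have "(U \<inter> E) \<union> (E - U) = E" by auto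
      ultimately show "outer_content E \<le> outer_content (U \<inter> E) + outer_content (E - U)" by simp
    qed
    then show "U \<in> caratheodory_sets"
      by (simp add: lambda_system_def Diff_eq Int_commute)
  qed
  then have "sigma_sets UNIV {S. open S} \<subseteq> caratheodory_sets"
    using caratheodory_measure unfolding measure_space_def by (intro sigma_algebra.sigma_sets_subset) auto
  then show ?thesis by (simp add: borel_def)
qed

definition content_measure :: "'x measure"
  where "content_measure = measure_of UNIV (sets borel) outer_content"

lemma sets_content_measure [simp, measurable_cong]: "sets content_measure = sets borel"
  using sets.sigma_sets_eq[of "borel :: 'x measure"]
  by (simp add: content_measure_def sets_measure_of)

lemma space_content_measure [simp]: "space content_measure = UNIV"
  unfolding content_measure_def by (simp add: space_measure_of_conv)

lemma emeasure_content_measure: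
  assumes "E \<in> sets borel" shows "emeasure content_measure E = outer_content E"
  unfolding content_measure_def
proof (rule emeasure_measure_of_sigma)
  show "sigma_algebra UNIV (sets (borel :: 'x measure))"
    using sets.sigma_algebra_axioms[of borel] by simp
  show "positive (sets borel) outer_content" by (simp add: positive_def outer_empty)
  have ca: "countably_additive caratheodory_sets outer_content"
    using caratheodory_measure by (simp add: measure_space_def)
  show "countably_additive (sets borel) outer_content"
  proof (rule countably_additiveI)
    fix A :: "nat \<Rightarrow> 'x set"
    assume "range A \<subseteq> sets borel" "disjoint_family A" "(\<Union>i. A i) \<in> sets borel"
    with borel_subset_caratheodory show "(\<Sum>i. outer_content (A i)) = outer_content (\<Union>i. A i)"
      by (intro ca[unfolded countably_additive_def, rule_format]) auto
  qed
qed fact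

lemma prob_space_content_measure: "prob_space content_measure"
  by (rule prob_spaceI) (simp add: emeasure_content_measure outer_UNIV)

text \<open>
  Outer regularity holds by construction; inner regularity is outer regularity of the complement, as
  closed sets are compact.
\<close>

lemma regular_content_measure: "regular_measure content_measure"
  unfolding regular_measure_def
proof (intro ballI conjI)
  interpret prob_space content_measure by (rule prob_space_content_measure)
  fix E :: "'x set" assume E: "E \<in> sets borel"
  have out: "emeasure content_measure E = (INF U\<in>{U. open U \<and> E \<subseteq> U}. emeasure content_measure U)"
    if "E \<in> sets borel" for E
  proof -
    have "(INF U\<in>{U. open U \<and> E \<subseteq> U}. emeasure content_measure U) = (INF U\<in>{U. open U \<and> E \<subseteq> U}. inner_content U)"
      by (rule INF_cong) (simp_all add: emeasure_content_measure outer_open)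
    then show ?thesis using that by (simp add: emeasure_content_measure outer_content_def)
  qed
  show "emeasure content_measure E = (INF U\<in>{U. open U \<and> E \<subseteq> U}. emeasure content_measure U)"
    using E by (rule out)
  show "emeasure content_measure E = (SUP K\<in>{K. compact K \<and> K \<subseteq> E}. emeasure content_measure K)"
  proof (rule antisym)
    show "(SUP K\<in>{K. compact K \<and> K \<subseteq> E}. emeasure content_measure K) \<le> emeasure content_measure E"
      using E by (intro SUP_least emeasure_mono) auto
    show "emeasure content_measure E \<le> (SUP K\<in>{K. compact K \<and> K \<subseteq> E}. emeasure content_measure K)"
    proof (rule ennreal_le_epsilon)
      fix e :: real assume e: "0 < e"
      have cE: "- E \<in> sets borel" using E by auto
      have "\<exists>U\<in>{U. open U \<and> - E \<subseteq> U}. emeasure content_measure U < emeasure content_measure (- E) + ennreal e"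
        using e out[OF cE] by (intro INF_approx_ennreal) (auto simp: emeasure_eq_measure)
      then obtain U where U: "open U" "- E \<subseteq> U" "emeasure content_measure U < emeasure content_measure (- E) + ennreal e"
        by blast
      have "measure content_measure U \<le> measure content_measure (- E) + e"
        using U(3) e by (simp add: emeasure_eq_measure ennreal_less_iff flip: ennreal_plus)
      moreover have "measure content_measure (- E) = 1 - measure content_measure E"
        using prob_compl[of E] E by (simp add: Compl_eq_Diff_UNIV)
      moreover have "measure content_measure (- U) = 1 - measure content_measure U"
        using prob_compl[of U] U(1) by (simp add: Compl_eq_Diff_UNIV)
      ultimately have "measure content_measure E \<le> measure content_measure (- U) + e" by simp
      then have "emeasure content_measure E \<le> emeasure content_measure (- U) + ennreal e"
        using e by (simp add: emeasure_eq_measure ennreal_leI flip: ennreal_plus)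
      moreover have "compact (- U)"
        using compact_Int_closed[OF space_compact, of "- U"] U(1) by (simp add: closed_Compl)
      then have "emeasure content_measure (- U) \<le> (SUP K\<in>{K. compact K \<and> K \<subseteq> E}. emeasure content_measure K)"
        using U(2) by (intro SUP_upper) auto
      ultimately show "emeasure content_measure E \<le> (SUP K\<in>{K. compact K \<and> K \<subseteq> E}. emeasure content_measure K) + ennreal e"
        by (meson add_right_mono order_trans)
    qed
  qed
qed

lemma content_measure_le: "open U \<Longrightarrow> measure content_measure U \<le> d U"
  using inner_le_d[of U] nonneg[of U]
  by (simp add: measure_def emeasure_content_measure outer_open enn2real_leI)

lemma le_content_measure:
  assumes "open W" "open U" "closure W \<subseteq> U" shows "d W \<le> measure content_measure U"
proof -
  interpret prob_space content_measure by (rule prob_space_content_measure)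
  have "ennreal (d W) \<le> ennreal (measure content_measure U)"
    using le_inner[OF assms(1,3)] assms(2)
    by (simp flip: emeasure_eq_measure add: emeasure_content_measure outer_open)
  then show ?thesis by simp
qed

text \<open>
  The construction uses only the topology and \<open>d\<close>, hence it commutes with homeomorphisms that preserve
  \<open>d\<close>.
\<close>

lemma distr_content_measure:
  assumes f: "homeomorphism UNIV UNIV f f'" and inv: "\<And>U. open U \<Longrightarrow> d (f -` U) = d U"
  shows "distr content_measure borel f = content_measure"
proof (rule measure_eqI)
  have cont: "continuous_on UNIV f" "continuous_on UNIV f'" and ff': "f (f' x) = x" "f' (f x) = x" for x
    using f by (auto simp: homeomorphism_def)
  have op: "open (f -` U)" "open (f' -` U)" if "open U" for U
    using open_vimage[OF that cont(1)] open_vimage[OF that cont(2)] by simp_all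
  have cl: "closed (f -` U)" "closed (f' -` U)" if "closed U" for U
    using op[of "- U"] that by (simp_all add: open_closed vimage_Compl)
  have eq: "f' -` (f -` U) = U" "f -` (f' -` U) = U" for U using ff' by auto
  have inner_inv: "inner_content (f -` U) = inner_content U" for U
  proof (rule antisym; rule inner_le)
    fix W assume W: "open W" "closure W \<subseteq> f -` U"
    have "closure (f' -` W) \<subseteq> f' -` closure W"
      using closure_subset[of W] by (intro closure_minimal cl) auto
    also have "\<dots> \<subseteq> U" using W(2) ff' by auto
    finally have "ennreal (d (f' -` W)) \<le> inner_content U" using op W(1) by (intro le_inner)
    then show "ennreal (d W) \<le> inner_content U" using inv[OF op(2)[OF W(1)]] by (simp add: eq)
  next
    fix W assume W: "open W" "closure W \<subseteq> U"
    have "closure (f -` W) \<subseteq> f -` closure W"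
      using closure_subset[of W] by (intro closure_minimal cl) auto
    also have "\<dots> \<subseteq> f -` U" using W(2) by auto
    finally have "ennreal (d (f -` W)) \<le> inner_content (f -` U)" using op W(1) by (intro le_inner)
    then show "ennreal (d W) \<le> inner_content (f -` U)" using inv[OF W(1)] by simp
  qed
  have outer_inv: "outer_content (f -` E) = outer_content E" for E
  proof (rule antisym; rule le_outer)
    fix U assume U: "open U" "E \<subseteq> U"
    have "outer_content (f -` E) \<le> inner_content (f -` U)" using U op by (intro outer_le) auto
    then show "outer_content (f -` E) \<le> inner_content U" by (simp add: inner_inv)
  next
    fix U assume U: "open U" "f -` E \<subseteq> U"
    have "E \<subseteq> f' -` U" using vimage_mono[OF U(2), of f'] by (simp only: eq)
    then have "outer_content E \<le> inner_content (f' -` U)" using U(1) op by (intro outer_le)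
    also have "\<dots> = inner_content U" using inner_inv[of "f' -` U"] by (simp add: eq)
    finally show "outer_content E \<le> inner_content U" .
  qed
  have meas: "f \<in> borel_measurable content_measure"
    using borel_measurable_continuous_onI[OF cont(1)]
    by (simp cong: measurable_cong_sets)
  show "sets (distr content_measure borel f) = sets content_measure" by simp
  fix E assume "E \<in> sets (distr content_measure borel f)"
  then have E: "E \<in> sets borel" by simp
  have "f -` E \<in> sets borel"
    using measurable_sets[OF meas E] by simp
  then show "emeasure (distr content_measure borel f) E = emeasure content_measure E"
    using E by (simp add: emeasure_distr[OF meas] emeasure_content_measure outer_inv)
qed

end

section \<open>Invariant measures\<close>

lemma dyn_subequivalentE:
  assumes "dyn_subequivalent G \<alpha> Os Vs" and F: "\<forall>i < length Os. closed (F i) \<and> F i \<subseteq> Os ! i"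
  obtains J :: "nat \<Rightarrow> nat" and U s and k :: "nat \<Rightarrow> nat \<Rightarrow> nat" where
    "\<forall>i < length Os. F i \<subseteq> (\<Union>j<J i. U i j)"
    "\<forall>i < length Os. \<forall>j < J i. open (U i j) \<and> s i j \<in> carrier G \<and> k i j < length Vs \<and>
        (\<alpha> (s i j) ` U i j) \<times> {k i j} \<subseteq> (\<Union>l<length Vs. (Vs ! l) \<times> {l})"
    "disjoint_family_on (\<lambda>(i, j). (\<alpha> (s i j) ` U i j) \<times> {k i j})
       (SIGMA i:{..<length Os}. {..<J i})"
proof -
  from assms(1)[unfolded dyn_subequivalent_def, THEN spec, THEN mp, OF F]
  obtain J :: "nat \<Rightarrow> nat" and U s and k :: "nat \<Rightarrow> nat \<Rightarrow> nat" where
    pieces: "\<forall>i < length Os. F i \<subseteq> (\<Union>j<J i. U i j) \<and>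
      (\<forall>j < J i. open (U i j) \<and> s i j \<in> carrier G \<and> k i j < length Vs \<and>
        (\<alpha> (s i j) ` U i j) \<times> {k i j} \<subseteq> (\<Union>l<length Vs. (Vs ! l) \<times> {l}))"
    and disj: "disjoint_family_on (\<lambda>(i, j). (\<alpha> (s i j) ` U i j) \<times> {k i j})
       (SIGMA i:{..<length Os}. {..<J i})"
    by (elim exE conjE)
  from pieces have "\<forall>i < length Os. F i \<subseteq> (\<Union>j<J i. U i j)" by simp
  moreover from pieces have "\<forall>i < length Os. \<forall>j < J i.
      open (U i j) \<and> s i j \<in> carrier G \<and> k i j < length Vs \<and>
        (\<alpha> (s i j) ` U i j) \<times> {k i j} \<subseteq> (\<Union>l<length Vs. (Vs ! l) \<times> {l})" by simp
  ultimately show ?thesis using disj by (rule that)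
qed

context topological_action
begin

lemma invariant_measure_of_content:
  assumes "open_content d"
    and inv: "\<And>g U. g \<in> carrier G \<Longrightarrow> open U \<Longrightarrow> d (\<alpha> g -` U) = d U"
  obtains \<mu> where "\<mu> \<in> invariant_measures G \<alpha>" "\<forall>U. open U \<longrightarrow> measure \<mu> U \<le> d U"
    "\<forall>W U. open W \<longrightarrow> open U \<longrightarrow> closure W \<subseteq> U \<longrightarrow> d W \<le> measure \<mu> U"
proof -
  interpret open_content d by fact
  have "distr content_measure borel (\<alpha> g) = content_measure" if g: "g \<in> carrier G" for g
  proof (rule distr_content_measure)
    show "homeomorphism UNIV UNIV (\<alpha> g) (\<alpha> (inv g))"
      by (rule homeomorphismI) (simp_all add: continuous_act g inv_in act_inv)
    show "d (\<alpha> g -` U) = d U" if "open U" for U using g that by (rule inv)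
  qed
  then have "content_measure \<in> invariant_measures G \<alpha>"
    by (simp add: invariant_measures_def prob_space_content_measure regular_content_measure)
  then show ?thesis
    by (rule that) (simp_all add: content_measure_le le_content_measure)
qed

text \<open>
  An orbit that avoids \<open>W\<close> gives an invariant content: the mean of the set of group elements that bring
  \<open>x\<close> into \<open>U\<close>. It vanishes on \<open>W\<close>, and so does the invariant measure that it yields.
\<close>

lemma orbit_meets_if_amenable:
  assumes "amenable_group G" and W: "open W"
    and pos: "\<And>\<mu>. \<mu> \<in> invariant_measures G \<alpha> \<Longrightarrow> measure \<mu> W > 0"
  shows "\<exists>g\<in>carrier G. \<alpha> g x \<in> W"
proof (rule ccontr)
  assume no: "\<not> (\<exists>g\<in>carrier G. \<alpha> g x \<in> W)"
  from assms(1) obtain m :: "'g set \<Rightarrow> real" where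
    m0: "\<forall>A \<subseteq> carrier G. 0 \<le> m A" and m_total: "m (carrier G) = 1" and
    m1: "\<forall>A \<subseteq> carrier G. \<forall>B \<subseteq> carrier G. A \<inter> B = {} \<longrightarrow> m (A \<union> B) = m A + m B" and
    m2: "\<forall>g \<in> carrier G. \<forall>A \<subseteq> carrier G. m (g <# A) = m A"
    unfolding amenable_group_def by (elim exE conjE)
  note m_nonneg = m0[rule_format] and m_add = m1[rule_format] and m_inv = m2[rule_format]
  define R where "R U = {g \<in> carrier G. \<alpha> g x \<in> U}" for U
  have R: "R U \<subseteq> carrier G" for U by (auto simp: R_def)
  have m_mono: "m A \<le> m B" if "A \<subseteq> B" "B \<subseteq> carrier G" for A B
  proof -
    have "m (A \<union> (B - A)) = m A + m (B - A)" using that by (intro m_add) auto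
    moreover have "0 \<le> m (B - A)" using that by (intro m_nonneg) auto
    moreover have "A \<union> (B - A) = B" using that by auto
    ultimately show ?thesis by simp
  qed
  have content: "open_content (\<lambda>U. m (R U))"
  proof
    show "compact (UNIV :: 'x set)" by (rule cpt)
    show "0 \<le> m (R U)" for U by (rule m_nonneg[OF R])
    show "m (R U) \<le> m (R V)" if "U \<subseteq> V" for U V
      using that by (intro m_mono R) (auto simp: R_def)
    show "m (R (U \<union> V)) \<le> m (R U) + m (R V)" for U V
    proof -
      have "m (R U \<union> R (V - U)) = m (R U) + m (R (V - U))"
        by (intro m_add R) (auto simp: R_def)
      moreover have "R U \<union> R (V - U) = R (U \<union> V)" by (auto simp: R_def)
      moreover have "m (R (V - U)) \<le> m (R V)" by (intro m_mono R) (auto simp: R_def)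
      ultimately show ?thesis by simp
    qed
    show "m (R U) + m (R V) \<le> m (R (U \<union> V))" if "U \<inter> V = {}" for U V
    proof -
      have "m (R U \<union> R V) = m (R U) + m (R V)"
        using that by (intro m_add R) (auto simp: R_def)
      moreover have "R U \<union> R V = R (U \<union> V)" by (auto simp: R_def)
      ultimately show ?thesis by simp
    qed
    show "m (R UNIV) = 1" by (simp add: R_def m_total)
  qed
  have inv: "m (R (\<alpha> h -` U)) = m (R U)" if h: "h \<in> carrier G" for h U
  proof -
    have "R (\<alpha> h -` U) = inv h <# R U"
    proof (rule Set.set_eqI)
      fix g
      show "g \<in> R (\<alpha> h -` U) \<longleftrightarrow> g \<in> inv h <# R U"
      proof
        assume "g \<in> R (\<alpha> h -` U)"
        then have g: "g \<in> carrier G" "\<alpha> (h \<otimes> g) x \<in> U" by (auto simp: R_def act_mult h)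
        then have "h \<otimes> g \<in> R U" using h by (simp add: R_def mult_in)
        moreover have "g = inv h \<otimes> (h \<otimes> g)"
          using monoid.m_assoc[OF group.is_monoid[OF grp], of "inv h" h g] h g(1)
          by (simp add: inv_in group.l_inv[OF grp] monoid.l_one[OF group.is_monoid[OF grp]])
        ultimately show "g \<in> inv h <# R U" unfolding l_coset_def by blast
      next
        assume "g \<in> inv h <# R U"
        then obtain k where k: "k \<in> carrier G" "\<alpha> k x \<in> U" "g = inv h \<otimes> k"
          unfolding l_coset_def R_def by blast
        then have "\<alpha> h (\<alpha> g x) = \<alpha> k x" using h by (simp add: act_mult inv_in act_inv)
        then show "g \<in> R (\<alpha> h -` U)" using k h by (simp add: R_def mult_in inv_in)
      qed
    qed
    then show ?thesis using m_inv[OF inv_in[OF h] R] by simp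
  qed
  obtain \<mu> where \<mu>: "\<mu> \<in> invariant_measures G \<alpha>" "\<forall>U. open U \<longrightarrow> measure \<mu> U \<le> m (R U)"
    by (rule invariant_measure_of_content[OF content inv])
  have "R W = {}" using no by (auto simp: R_def)
  moreover have "m {} = 0" using m_add[of "{}" "{}"] by simp
  ultimately show False using pos[OF \<mu>(1)] \<mu>(2) W by fastforce
qed

text \<open>
  If no multiple worked, a state with \<open>D(W) \<le> 1 \<le> D(A)\<close> would exist. It yields an invariant measure
  giving \<open>W\<close> at most, and \<open>V\<close> at least, the common value \<open>1\<close> up to scaling.
\<close>

lemma multiple_below_if_measure_less:
  assumes A: "open A" and V: "open V" and AV: "closure A \<subseteq> V" and W: "open W"
    and meets: "\<And>x. \<exists>g\<in>carrier G. \<alpha> g x \<in> W"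
    and less: "\<And>\<mu>. \<mu> \<in> invariant_measures G \<alpha> \<Longrightarrow> measure \<mu> V < measure \<mu> W"
  shows "\<exists>n>0. mset_below (repeat_mset (n + 1) {#A#}) (repeat_mset n {#W#})"
proof (rule ccontr)
  assume no: "\<not> ?thesis"
  have unit: "\<exists>n. mset_below M (repeat_mset n {#W#})" for M
    using W meets by (rule order_unit)
  have not_below: "\<not> mset_below (repeat_mset (n + 1) {#A#}) (repeat_mset n {#W#})" if "n > 0" for n
    using no that by blast
  obtain D :: "'x set multiset \<Rightarrow> real" where D0: "\<forall>x. 0 \<le> D x" "\<forall>x y. mset_below x y \<longrightarrow> D x \<le> D y"
    "\<forall>x y. D (x + y) = D x + D y" and D_W: "D {#W#} \<le> 1" and D_A: "1 \<le> D {#A#}"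
    by (rule separating_state[OF unit not_below])
  note D_nonneg = D0(1)[rule_format] and D_mono = D0(2)[rule_format] and D_add = D0(3)[rule_format]
  \<comment> \<open>The state is normalized at \<open>W\<close>, while a content has to be normalized at the whole space.\<close>
  define c where "c = D {#UNIV#}"
  have c: "c \<ge> 1"
    using D_A D_mono[OF mset_below_mono[of A UNIV]] by (simp add: c_def)
  define d where "d U = D {#U#} / c" for U
  have pair: "D {#U, V#} = D {#U#} + D {#V#}" for U V
    using D_add[of "{#U#}" "{#V#}"] by (simp add: add_mset_commute)
  have content: "open_content d"
  proof
    show "compact (UNIV :: 'x set)" by (rule cpt)
    show "0 \<le> d U" for U using c D_nonneg by (simp add: d_def)
    show "d U \<le> d V" if "U \<subseteq> V" for U V
      using c D_mono[OF mset_below_mono[OF that]] by (simp add: d_def divide_right_mono)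
    show "d (U \<union> V) \<le> d U + d V" if "open U" "open V" for U V
      using c D_mono[OF mset_below_Un[OF that]]
      by (simp add: d_def pair divide_right_mono flip: add_divide_distrib)
    show "d U + d V \<le> d (U \<union> V)" if "open U" "open V" "U \<inter> V = {}" for U V
      using c D_mono[OF mset_below_disjoint_Un[OF that]]
      by (simp add: d_def pair divide_right_mono flip: add_divide_distrib)
    show "d UNIV = 1" using c by (simp add: d_def c_def)
  qed
  have inv: "d (\<alpha> g -` U) = d U" if g: "g \<in> carrier G" and U: "open U" for g U
  proof -
    have op: "open (\<alpha> g -` U)" using g U by (rule open_act_vimage)
    have "mset_below {#\<alpha> g -` U#} {#U#}"
      by (rule mset_below_translate[OF g op U]) auto
    moreover have "mset_below {#U#} {#\<alpha> g -` U#}"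
      by (rule mset_below_translate[OF inv_in[OF g] U op]) (auto simp: act_inv g)
    ultimately show ?thesis using D_mono by (simp add: d_def order_antisym)
  qed
  obtain \<mu> where \<mu>: "\<mu> \<in> invariant_measures G \<alpha>" "\<forall>U. open U \<longrightarrow> measure \<mu> U \<le> d U"
    "\<forall>W U. open W \<longrightarrow> open U \<longrightarrow> closure W \<subseteq> U \<longrightarrow> d W \<le> measure \<mu> U"
    by (rule invariant_measure_of_content[OF content inv])
  have "measure \<mu> W \<le> d W" "d A \<le> measure \<mu> V" using \<mu>(2,3) A V W AV by simp_all
  moreover have "d W \<le> d A" using D_W D_A c by (simp add: d_def divide_right_mono)
  ultimately show False using less[OF \<mu>(1)] by simp
qed

lemma measure_act_image:
  assumes \<mu>: "\<mu> \<in> invariant_measures G \<alpha>" and g: "g \<in> carrier G" and U: "open U"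
  shows "measure \<mu> (\<alpha> g ` U) = measure \<mu> U"
proof -
  have sets: "sets \<mu> = sets borel" and inv: "distr \<mu> borel (\<alpha> (inv g)) = \<mu>"
    using \<mu> inv_in[OF g] by (auto simp: invariant_measures_def)
  have space: "space \<mu> = UNIV" using sets_eq_imp_space_eq[OF sets] by simp
  have "\<alpha> (inv g) \<in> borel_measurable borel"
    by (rule borel_measurable_continuous_onI[OF continuous_act[OF inv_in[OF g]]])
  then have meas: "\<alpha> (inv g) \<in> measurable \<mu> borel"
    using measurable_cong_sets[OF sets refl] by blast
  have "measure (distr \<mu> borel (\<alpha> (inv g))) U = measure \<mu> (\<alpha> (inv g) -` U \<inter> space \<mu>)"
    using U by (intro measure_distr[OF meas]) simp
  then show ?thesis by (simp add: inv space act_image[OF g])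
qed

text \<open>
  For closed \<open>F \<subseteq> A\<close>, the pieces covering the \<open>m\<close> copies of \<open>F\<close> have total measure at least
  \<open>m \<mu>(F)\<close>. Grouped by the copy of \<open>B\<close> into which they are moved, their translates are disjoint
  subsets of \<open>B\<close>, so the total is at most \<open>n \<mu>(B)\<close>. Inner regularity gives the claim for \<open>A\<close>.
\<close>

lemma measure_le_if_dyn_subequivalent:
  assumes \<mu>: "\<mu> \<in> invariant_measures G \<alpha>" and A: "open A" and B: "open B"
    and sub: "dyn_subequivalent G \<alpha> (replicate m A) (replicate n B)"
  shows "real m * measure \<mu> A \<le> real n * measure \<mu> B"
proof (cases "m = 0")
  case False
  have sets: "sets \<mu> = sets borel" and reg: "regular_measure \<mu>" and prob: "prob_space \<mu>"
    using \<mu> by (auto simp: invariant_measures_def)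
  interpret prob_space \<mu> by (rule prob)
  have open_sets: "S \<in> sets \<mu>" if "open S" for S using that sets by simp
  have closed_bound: "real m * measure \<mu> F \<le> real n * measure \<mu> B" if F: "closed F" "F \<subseteq> A" for F
  proof -
    have ok: "\<forall>i < length (replicate m A). closed F \<and> F \<subseteq> replicate m A ! i" using F by simp
    obtain J :: "nat \<Rightarrow> nat" and U s and k :: "nat \<Rightarrow> nat \<Rightarrow> nat" where
      cover: "\<forall>i < length (replicate m A). F \<subseteq> (\<Union>j<J i. U i j)" and
      pieces: "\<forall>i < length (replicate m A). \<forall>j < J i.
          open (U i j) \<and> s i j \<in> carrier G \<and> k i j < length (replicate n B) \<and>
          (\<alpha> (s i j) ` U i j) \<times> {k i j} \<subseteq> (\<Union>l<length (replicate n B). (replicate n B ! l) \<times> {l})"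
      and disj: "disjoint_family_on (\<lambda>(i, j). (\<alpha> (s i j) ` U i j) \<times> {k i j})
             (SIGMA i:{..<length (replicate m A)}. {..<J i})"
      by (rule dyn_subequivalentE[OF sub, of "\<lambda>_. F", OF ok])
    define I where "I = (SIGMA i:{..<m}. {..<J i})"
    define T where "T p = \<alpha> (s (fst p) (snd p)) ` U (fst p) (snd p)" for p
    define K where "K p = k (fst p) (snd p)" for p
    have piece: "open (U i j)" "s i j \<in> carrier G" "k i j < n" if "i < m" "j < J i" for i j
      using pieces that by simp_all
    have disj': "disjoint_family_on (\<lambda>p. T p \<times> {K p}) I"
      using disj by (simp add: I_def T_def K_def case_prod_unfold)
    have into_B: "T p \<subseteq> B" if p: "p \<in> I" for p
    proof
      obtain i j where ij: "p = (i, j)" "i < m" "j < J i" using p by (auto simp: I_def)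
      fix y assume "y \<in> T p"
      then have "(y, k i j) \<in> (\<alpha> (s i j) ` U i j) \<times> {k i j}" by (simp add: T_def ij(1))
      also have "\<dots> \<subseteq> (\<Union>l<n. (replicate n B ! l) \<times> {l})" using pieces ij(2,3) by simp
      finally show "y \<in> B" by auto
    qed
    have open_T: "open (T p)" if "p \<in> I" for p
      using that piece by (auto simp: I_def T_def intro!: open_act_image)
    have fin: "finite I" by (simp add: I_def)
    have "real m * measure \<mu> F = (\<Sum>i<m. measure \<mu> F)" by simp
    also have "\<dots> \<le> (\<Sum>i<m. \<Sum>j<J i. measure \<mu> (U i j))"
    proof (rule sum_mono)
      fix i assume "i \<in> {..<m}"
      then have i: "i < m" by simp
      have "measure \<mu> F \<le> measure \<mu> (\<Union>j<J i. U i j)"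
        using cover i piece[OF i] by (intro finite_measure_mono open_sets open_UN) auto
      also have "\<dots> \<le> (\<Sum>j<J i. measure \<mu> (U i j))"
        using piece[OF i] by (intro finite_measure_subadditive_finite) (auto intro: open_sets)
      finally show "measure \<mu> F \<le> (\<Sum>j<J i. measure \<mu> (U i j))" .
    qed
    also have "\<dots> = (\<Sum>i<m. \<Sum>j<J i. measure \<mu> (T (i, j)))"
      using piece by (intro sum.cong refl) (simp add: T_def measure_act_image[OF \<mu>])
    also have "\<dots> = (\<Sum>p\<in>I. measure \<mu> (T p))"
      unfolding I_def by (subst sum.Sigma) auto
    also have "\<dots> = (\<Sum>l<n. \<Sum>p\<in>{p\<in>I. K p = l}. measure \<mu> (T p))"
      using fin piece by (intro sum.group[symmetric]) (auto simp: I_def K_def)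
    also have "\<dots> \<le> (\<Sum>l<n. measure \<mu> B)"
    proof (rule sum_mono)
      fix l
      have "disjoint_family_on T {p\<in>I. K p = l}"
        unfolding disjoint_family_on_def
      proof (intro ballI impI)
        fix p q assume p: "p \<in> {p\<in>I. K p = l}" and q: "q \<in> {p\<in>I. K p = l}" and "p \<noteq> q"
        then have "T p \<times> {K p} \<inter> T q \<times> {K q} = {}"
          using disjoint_family_onD[OF disj'] by blast
        then show "T p \<inter> T q = {}" using p q by auto
      qed
      then have "(\<Sum>p\<in>{p\<in>I. K p = l}. measure \<mu> (T p)) = measure \<mu> (\<Union>p\<in>{p\<in>I. K p = l}. T p)"
        using fin open_T by (intro finite_measure_finite_Union[symmetric]) (auto intro: open_sets)
      also have "\<dots> \<le> measure \<mu> B"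
        using into_B B by (intro finite_measure_mono open_sets) auto
      finally show "(\<Sum>p\<in>{p\<in>I. K p = l}. measure \<mu> (T p)) \<le> measure \<mu> B" .
    qed
    finally show ?thesis by simp
  qed
  have "emeasure \<mu> A = (SUP F\<in>{F. compact F \<and> F \<subseteq> A}. emeasure \<mu> F)"
    using reg A unfolding regular_measure_def by simp
  also have "\<dots> \<le> ennreal (real n * measure \<mu> B / real m)"
  proof (rule SUP_least)
    fix F assume "F \<in> {F. compact F \<and> F \<subseteq> A}"
    then have "real m * measure \<mu> F \<le> real n * measure \<mu> B"
      by (intro closed_bound) (auto intro: compact_imp_closed)
    then show "emeasure \<mu> F \<le> ennreal (real n * measure \<mu> B / real m)"
      using False by (simp add: emeasure_eq_measure ennreal_leI field_simps)
  qed
  finally have "measure \<mu> A \<le> real n * measure \<mu> B / real m"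
    by (simp add: emeasure_eq_measure)
  then show ?thesis using False by (simp add: field_simps)
qed simp

text \<open>
  When there is no invariant measure, a set that is positive for all of them may still be empty; this
  is the case that comparison does not speak of.
\<close>

lemma dyn_subequivalent_empty_imp_empty:
  assumes "dyn_subequivalent G \<alpha> (replicate m A) (replicate n {})" "m > 0"
  shows "A = {}"
proof (rule ccontr)
  assume "A \<noteq> {}"
  then obtain x where x: "x \<in> A" by blast
  have ok: "\<forall>i < length (replicate m A). closed {x} \<and> {x} \<subseteq> replicate m A ! i" using x by simp
  obtain J :: "nat \<Rightarrow> nat" and U s and k :: "nat \<Rightarrow> nat \<Rightarrow> nat" where
    cover: "\<forall>i < length (replicate m A). {x} \<subseteq> (\<Union>j<J i. U i j)" and
    pieces: "\<forall>i < length (replicate m A). \<forall>j < J i.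
        open (U i j) \<and> s i j \<in> carrier G \<and> k i j < length (replicate n ({} :: 'x set)) \<and>
        (\<alpha> (s i j) ` U i j) \<times> {k i j}
          \<subseteq> (\<Union>l<length (replicate n ({} :: 'x set)). (replicate n ({} :: 'x set) ! l) \<times> {l})"
    by (rule dyn_subequivalentE[OF assms(1), of "\<lambda>_. {x}", OF ok])
  have "{x} \<subseteq> (\<Union>j<J 0. U 0 j)" using cover assms(2) by simp
  then obtain j where j: "j < J 0" "x \<in> U 0 j" by blast
  have "(\<alpha> (s 0 j) ` U 0 j) \<times> {k 0 j} \<subseteq> (\<Union>l<n. (replicate n ({} :: 'x set) ! l) \<times> {l})"
    using pieces assms(2) j(1) by simp
  with j(2) show False by auto
qed

lemma dyn_subequivalent_empty: "dyn_subequivalent G \<alpha> [{}] [B]"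
proof (rule dyn_subequivalent_if_below)
  show "below moves (stack [{}]) (stack [B])" by (simp add: stack_def below_empty)
qed simp

end

section \<open>Cancellation and dynamical comparison\<close>

theorem theoremC:
  fixes G :: "('g, 'b) monoid_scheme"
    and \<alpha> :: "'g \<Rightarrow> 'x::metric_space \<Rightarrow> 'x"
  assumes "group G" and "countable (carrier G)" and "infinite (carrier G)"
    and "compact (UNIV :: 'x set)" and "infinite (UNIV :: 'x set)"
    and "continuous_action G \<alpha>"
    and "amenable_group G \<or> minimal_action G \<alpha>"
  shows
    "(\<forall>A B. open A \<longrightarrow> open B \<longrightarrow>
        (\<forall>\<mu> \<in> invariant_measures G \<alpha>. measure \<mu> B > 0) \<longrightarrow>
        (\<exists>n > 0. dyn_subequivalent G \<alpha> (replicate (n + 1) A) (replicate n B)) \<longrightarrow>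
        dyn_subequivalent G \<alpha> [A] [B])
     \<longleftrightarrow> dynamical_comparison G \<alpha>"
proof -
  interpret topological_action G \<alpha> by (rule topological_action.intro) (fact assms)+
  show ?thesis
  proof
    assume cancel: "\<forall>A B. open A \<longrightarrow> open B \<longrightarrow>
        (\<forall>\<mu> \<in> invariant_measures G \<alpha>. measure \<mu> B > 0) \<longrightarrow>
        (\<exists>n > 0. dyn_subequivalent G \<alpha> (replicate (n + 1) A) (replicate n B)) \<longrightarrow>
        dyn_subequivalent G \<alpha> [A] [B]"
    show "dynamical_comparison G \<alpha>"
      unfolding dynamical_comparison_def
    proof (intro allI impI)
      fix V W assume V: "open V" and W: "open W" "W \<noteq> {}"
        and less: "\<forall>\<mu> \<in> invariant_measures G \<alpha>. measure \<mu> V < measure \<mu> W"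
      have pos: "measure \<mu> W > 0" if "\<mu> \<in> invariant_measures G \<alpha>" for \<mu>
        using less that measure_nonneg[of \<mu> V] by (meson le_less_trans)
      have meets: "\<exists>g\<in>carrier G. \<alpha> g x \<in> W" for x
        using assms(7)
      proof
        assume "amenable_group G"
        then show ?thesis using W(1) pos by (rule orbit_meets_if_amenable)
      next
        assume "minimal_action G \<alpha>"
        then have "closure (orbit G \<alpha> x) = UNIV" by (simp add: minimal_action_def)
        then have "W \<inter> orbit G \<alpha> x \<noteq> {}"
          using W open_Int_closure_eq_empty[OF W(1), of "orbit G \<alpha> x"] by simp
        then show ?thesis by (auto simp: orbit_def)
      qed
      show "dyn_subequivalent G \<alpha> [V] [W]"
        unfolding dyn_subequivalent_def
      proof (intro allI impI)
        fix F :: "nat \<Rightarrow> 'x set" assume F: "\<forall>i < length [V]. closed (F i) \<and> F i \<subseteq> [V] ! i"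
        then have F0: "closed (F 0)" "F 0 \<subseteq> V" by auto
        have K: "compact (F 0)" using compact_Int_closed[OF cpt F0(1)] by simp
        have cover: "F 0 \<subseteq> (\<Union>u\<in>{()}. V)" using F0(2) by simp
        obtain A' where A': "\<forall>u. open (A' u)" "\<forall>u\<in>{()}. closure (A' u) \<subseteq> V" "F 0 \<subseteq> (\<Union>u\<in>{()}. A' u)"
          by (rule compact_shrinking[OF K V cover])
        define A where "A = A' ()"
        have A: "open A" "closure A \<subseteq> V" "F 0 \<subseteq> A" using A' by (auto simp: A_def)
        have "\<exists>n>0. mset_below (repeat_mset (n + 1) {#A#}) (repeat_mset n {#W#})"
          using less by (intro multiple_below_if_measure_less[OF A(1) V A(2) W(1) meets]) simp
        then have "\<exists>n>0. dyn_subequivalent G \<alpha> (replicate (n + 1) A) (replicate n W)"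
          using dyn_subequivalent_if_mset_below[OF A(1)] by blast
        then have "dyn_subequivalent G \<alpha> [A] [W]"
          using pos by (intro cancel[rule_format, OF A(1) W(1)])
        moreover have "\<forall>i < length [A]. closed (F i) \<and> F i \<subseteq> [A] ! i" using F0(1) A(3) by simp
        ultimately show "\<exists>(J :: nat \<Rightarrow> nat) (U :: nat \<Rightarrow> nat \<Rightarrow> 'x set) (s :: nat \<Rightarrow> nat \<Rightarrow> 'g) (k :: nat \<Rightarrow> nat \<Rightarrow> nat).
           (\<forall>i < length [V].
              F i \<subseteq> (\<Union>j<J i. U i j) \<and>
              (\<forall>j < J i.
                 open (U i j) \<and> s i j \<in> carrier G \<and> k i j < length [W] \<and>
                 (\<alpha> (s i j) ` U i j) \<times> {k i j} \<subseteq> (\<Union>l<length [W]. ([W] ! l) \<times> {l}))) \<and>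
           disjoint_family_on (\<lambda>(i, j). (\<alpha> (s i j) ` U i j) \<times> {k i j})
             (SIGMA i:{..<length [V]}. {..<J i})"
          unfolding dyn_subequivalent_def by simp
      qed
    qed
  next
    assume comparison: "dynamical_comparison G \<alpha>"
    show "\<forall>A B. open A \<longrightarrow> open B \<longrightarrow>
        (\<forall>\<mu> \<in> invariant_measures G \<alpha>. measure \<mu> B > 0) \<longrightarrow>
        (\<exists>n > 0. dyn_subequivalent G \<alpha> (replicate (n + 1) A) (replicate n B)) \<longrightarrow>
        dyn_subequivalent G \<alpha> [A] [B]"
    proof (intro allI impI)
      fix A B assume A: "open A" and B: "open B"
        and pos: "\<forall>\<mu> \<in> invariant_measures G \<alpha>. measure \<mu> B > 0"
        and "\<exists>n > 0. dyn_subequivalent G \<alpha> (replicate (n + 1) A) (replicate n B)"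
      then obtain n where sub: "dyn_subequivalent G \<alpha> (replicate (n + 1) A) (replicate n B)" by blast
      show "dyn_subequivalent G \<alpha> [A] [B]"
      proof (cases "B = {}")
        case True
        then have "A = {}" using dyn_subequivalent_empty_imp_empty[of "n + 1" A n] sub by simp
        then show ?thesis using dyn_subequivalent_empty by simp
      next
        case False
        have "measure \<mu> A < measure \<mu> B" if \<mu>: "\<mu> \<in> invariant_measures G \<alpha>" for \<mu>
        proof -
          have "(real n + 1) * measure \<mu> A \<le> real n * measure \<mu> B"
            using measure_le_if_dyn_subequivalent[OF \<mu> A B sub] by (simp add: add.commute)
          also have "\<dots> < (real n + 1) * measure \<mu> B" using pos \<mu> by simp
          finally show ?thesis by (simp add: mult_less_cancel_left_pos)
        qed
        then show ?thesis
          by (rule comparison[unfolded dynamical_comparison_def, rule_format, OF A B False])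
      qed
    qed
  qed
qed

end
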